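(* Assume that $r_1,\dots,r_k$ are bounded and Riemann integrable, that $\lim_{N\to\infty}(N\varepsilon_N)^{-1}(\log N)^{\xi}=0$ for some fixed $\xi>8$, and that $\lim_{N\to\infty}\varepsilon_N=\varepsilon_\infty$ for some $\varepsilon_\infty\ge 0$. Then, for every $1\le i\le k$, $$\lambda_i(A_N)=N\varepsilon_N\theta_i\left(1+o_{hp}(1)\right).$$
   Context: Setting. Let $k\ge 1$, let $\theta_1\ge\dots\ge\theta_k>0$, and let $r_1,\dots,r_k:[0,1]\to\mathbb{R}$ be an orthonormal set in $L^2[0,1]$ such that $f(x,y):=\sum_{i=1}^k\theta_i r_i(x)r_i(y)\ge 0$ for all $(x,y)\in[0,1]^2$. Let $(\varepsilon_N)_{N\ge1}$ be a real sequence with $0<\varepsilon_N\le\left[\sup_{0\le x,y\le 1}f(x,y)\right]^{-1}$. For each $N\ge 1$, $A_N$ is the $N\times N$ random symmetric matrix whose entries $\{A_N(i,j):1\le i\le j\le N\}$ are independent with $A_N(i,j)\sim\mathrm{Bernoulli}(\varepsilon_N f(i/N,j/N))$ (the adjacency matrix of an inhomogeneous Erdős–Rényi graph, self-loops allowed). For a real symmetric matrix $M$, $\lambda_1(M)\ge\lambda_2(M)\ge\cdots$ denote its eigenvalues. Notation. A sequence of events $E_N$ occurs with high probability (w.h.p.) if $P(E_N^c)=O\left(e^{-(\log N)^\eta}\right)$ for some $\eta>1$. For random variables $Y_N,Z_N$, $Y_N=o_{hp}(Z_N)$ means that for all $\delta>0$, $|Y_N|\le\delta|Z_N|$ w.h.p.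 *)

theory Defs
  imports "HOL-Probability.Probability" "HOL-Library.Landau_Symbols"
    "Jordan_Normal_Form.Char_Poly"
begin

(* The i-th largest eigenvalue, counted from i = 1 and with algebraic multiplicity.
   A real symmetric n x n matrix has n real eigenvalues, so this is meaningful
   for 1 \<le> i \<le> n only. *)
definition eigval :: "nat \<Rightarrow> real mat \<Rightarrow> real" where
  "eigval i A = rev (sorted_list_of_multiset (proots (char_poly A))) ! (i - 1)"

definition kernel_fun :: "nat \<Rightarrow> (nat \<Rightarrow> real) \<Rightarrow> (nat \<Rightarrow> real \<Rightarrow> real) \<Rightarrow> real \<Rightarrow> real \<Rightarrow> real" where
  "kernel_fun k \<theta> r x y = (\<Sum>i = 1..k. \<theta> i * r i x * r i y)"

(* The measure is "lebesgue" rather than "lborel" because a Riemann integrable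
   function need not be Borel measurable. *)
definition orthonormal_L2 :: "nat \<Rightarrow> (nat \<Rightarrow> real \<Rightarrow> real) \<Rightarrow> bool" where
  "orthonormal_L2 k r \<longleftrightarrow>
     (\<forall>i\<in>{1..k}. set_borel_measurable lebesgue {0..1} (r i) \<and>
                 set_integrable lebesgue {0..1} (\<lambda>x. (r i x)\<^sup>2)) \<and>
     (\<forall>i\<in>{1..k}. \<forall>j\<in>{1..k}.
        (LINT x:{0..1}|lebesgue. r i x * r j x) = (if i = j then 1 else 0))"

(* Riemann integrability via tagged partitions of mesh less than d; the library's
   "integrable_on" is the strictly weaker Henstock-Kurzweil notion. *)
definition riemann_integrable :: "real \<Rightarrow> real \<Rightarrow> (real \<Rightarrow> real) \<Rightarrow> bool" where
  "riemann_integrable a b g \<longleftrightarrow>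
     (\<exists>I. \<forall>e>0. \<exists>d>0. \<forall>p. p tagged_division_of {a..b} \<and> (\<forall>(x, K)\<in>p. measure lborel K < d) \<longrightarrow>
        \<bar>(\<Sum>(x, K)\<in>p. measure lborel K * g x) - I\<bar> < e)"

(* E N is an event of the N-th probability space.  Measurability is asked for large N
   only, as finitely many N are irrelevant to the asymptotic statement. *)
definition whp :: "(nat \<Rightarrow> 'a measure) \<Rightarrow> (nat \<Rightarrow> 'a set) \<Rightarrow> bool" where
  "whp M E \<longleftrightarrow>
     (\<forall>\<^sub>F N in sequentially. E N \<in> sets (M N)) \<and>
     (\<exists>\<eta>>1. (\<lambda>N. measure (M N) (space (M N) - E N)) \<in> O(\<lambda>N. exp (- (ln (real N) powr \<eta>))))"

definition small_o_hp ::
    "(nat \<Rightarrow> 'a measure) \<Rightarrow> (nat \<Rightarrow> 'a \<Rightarrow> real) \<Rightarrow> (nat \<Rightarrow> 'a \<Rightarrow> real) \<Rightarrow> bool" where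
  "small_o_hp M Y Z \<longleftrightarrow>
     (\<forall>\<delta>>0. whp M (\<lambda>N. {\<omega> \<in> space (M N). \<bar>Y N \<omega>\<bar> \<le> \<delta> * \<bar>Z N \<omega>\<bar>}))"

(* Matrices are indexed from 0, whence the shift; p i j is used for 1 \<le> i \<le> j \<le> N only. *)
definition bernoulli_sym_matrix ::
    "'a measure \<Rightarrow> nat \<Rightarrow> (nat \<Rightarrow> nat \<Rightarrow> real) \<Rightarrow> ('a \<Rightarrow> real mat) \<Rightarrow> bool" where
  "bernoulli_sym_matrix M N p A \<longleftrightarrow>
     (\<forall>\<omega>\<in>space M. A \<omega> \<in> carrier_mat N N \<and> transpose_mat (A \<omega>) = A \<omega>) \<and>
     prob_space.indep_vars M (\<lambda>_. borel) (\<lambda>(i, j) \<omega>. A \<omega> $$ (i - 1, j - 1))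
       {(i, j). 1 \<le> i \<and> i \<le> j \<and> j \<le> N} \<and>
     (\<forall>i j. 1 \<le> i \<and> i \<le> j \<and> j \<le> N \<longrightarrow>
        distr M borel (\<lambda>\<omega>. A \<omega> $$ (i - 1, j - 1)) =
        distr (measure_pmf (bernoulli_pmf (p i j))) borel of_bool)"

end

theory Submission
  imports Defs "HOL-Real_Asymp.Real_Asymp"
begin

text \<open>
  Write \<open>A\<^sub>N = E A\<^sub>N + W\<close>. The mean \<open>E A\<^sub>N\<close> is \<open>\<epsilon>\<^sub>N \<Sum>\<^sub>j \<theta>\<^sub>j v\<^sub>j v\<^sub>j\<^sup>T\<close>, where \<open>v\<^sub>j\<close> samples \<open>r\<^sub>j\<close>
  at the points \<open>s/N\<close>. By Riemann integrability the Gram matrix of the \<open>v\<^sub>j\<close> is \<open>N (I + o(1))\<close>, so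
  by min-max the eigenvalues of \<open>E A\<^sub>N\<close> are \<open>N \<epsilon>\<^sub>N \<theta>\<^sub>i (1 + o(1))\<close>, and it is enough that
  \<open>\<parallel>W\<parallel> = o(N \<epsilon>\<^sub>N)\<close> with high probability.

  For this, \<open>\<parallel>W\<parallel>\<^bsup>2m\<^esup> \<le> tr W\<^bsup>2m\<^esup>\<close> with \<open>m\<close> about \<open>(log N)\<^sup>2\<close>. In the expansion of \<open>E tr W\<^bsup>2m\<^esup>\<close> over
  walks only those traversing each edge at least twice survive. They have at most \<open>m\<close> distinct edges, hence at most
  \<open>m + 1\<close> vertices. Crudely counting the walks on \<open>v\<close> vertices by \<open>N\<^sup>v v\<^bsup>2m+1\<^esup>\<close> costs a factor of about
  \<open>m\<^bsup>2m\<^esup>\<close>, which is harmless since \<open>N \<epsilon>\<^sub>N\<close> eventually exceeds \<open>(log N)\<^sup>8\<close>, and Markov's inequality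
  gives the failure probability \<open>exp (- (log N)\<^sup>2)\<close>.
\<close>

section \<open>Spectral theorem for real symmetric matrices\<close>

text \<open>The exponents are tied together. Dividing the moment bound by the threshold leaves
  \<open>N (m+1)^2 \<rho>^m\<close>, with \<open>\<rho>\<close> a constant times
  \<open>(m+1)^2 / (N \<epsilon>)\<close>. If \<open>\<rho>\<close> is merely kept below a constant
  less than 1, a failure probability of \<open>exp (- (log N)^2)\<close> asks for \<open>m\<close>
  of order \<open>(log N)^2\<close>; then \<open>(m+1)^2\<close> is of order
  \<open>(log N)^4\<close>, which \<open>N \<epsilon> \<ge> (log N)^8\<close> drives
  \<open>\<rho>\<close> to zero. Norms never appear as such: the noise is controlled through its
  quadratic form, and the min-max bounds are tested directly on the sampled vectors. These are only
  nearly orthogonal, so the variational statements allow arbitrary test vectors. The Gram error then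
  takes a deterministic half of the tolerance, the noise the other half. The Gram matrix samples
  products \<open>r a * r b\<close>. Their integrals are known as Lebesgue integrals, whereas
  Riemann integrability is given for the factors alone; oscillation sums bridge the two.\<close>

lemma eigenvalue_symmetric_real:
  fixes A :: "real mat"
  assumes A: "A \<in> carrier_mat n n" and sym: "transpose_mat A = A"
    and ev: "eigenvalue (map_mat complex_of_real A) c"
  shows "c \<in> \<real>"
proof -
  let ?A = "map_mat complex_of_real A"
  from ev obtain v where v: "v \<in> carrier_vec n" and v0: "v \<noteq> 0\<^sub>v n" and
    Av: "?A *\<^sub>v v = c \<cdot>\<^sub>v v"
    using A unfolding eigenvalue_def eigenvector_def by auto
  define x where "x s = vec_index v s" for s
  have symA: "A $$ (s,t) = A $$ (t,s)" if "s < n" "t < n" for s t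
    using arg_cong[OF sym, of "\<lambda>B. B $$ (s,t)"] A that by auto
  have eq: "(\<Sum>t<n. A $$ (s,t) * x t) = c * x s" if "s < n" for s
  proof -
    have "vec_index (?A *\<^sub>v v) s = (\<Sum>t<n. A $$ (s,t) * x t)"
      using that A v by (auto simp: scalar_prod_def x_def lessThan_atLeast0)
    thus ?thesis unfolding Av using that v by (auto simp: x_def)
  qed
  \<comment> \<open>The Hermitian form of \<open>A\<close> at the eigenvector. The eigenvector
    equation evaluates it to \<open>c\<close> times the squared norm, and symmetry makes it its own
    conjugate.\<close>
  define q where "q = (\<Sum>s<n. \<Sum>t<n. cnj (x s) * (A $$ (s,t) * x t))"
  define S where "S = (\<Sum>s<n. (cmod (x s))\<^sup>2)"
  have q1: "q = c * of_real S"
  proof -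
    have "q = (\<Sum>s<n. cnj (x s) * (\<Sum>t<n. A $$ (s,t) * x t))"
      unfolding q_def by (simp add: sum_distrib_left)
    also have "\<dots> = (\<Sum>s<n. cnj (x s) * (c * x s))"
      using eq by simp
    also have "\<dots> = c * of_real S"
      unfolding S_def of_real_sum sum_distrib_left
      by (intro sum.cong refl) (metis complex_norm_square mult.commute mult.left_commute of_real_power)
    finally show ?thesis .
  qed
  have q2: "cnj q = q"
  proof -
    have "cnj q = (\<Sum>s<n. \<Sum>t<n. x s * (A $$ (s,t) * cnj (x t)))"
      unfolding q_def by simp
    also have "\<dots> = (\<Sum>t<n. \<Sum>s<n. x s * (A $$ (s,t) * cnj (x t)))"
      by (rule sum.swap)
    also have "\<dots> = q"
      unfolding q_def by (intro sum.cong refl) (auto simp: symA)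
    finally show ?thesis .
  qed
  from v0 v obtain s where s: "s < n" "x s \<noteq> 0" unfolding x_def by (auto simp: vec_eq_iff)
  have "S > 0" unfolding S_def
    by (rule sum_pos2[of _ s]) (use s in auto)
  have "cnj c * of_real S = c * of_real S" using q1 q2 by (metis complex_cnj_complex_of_real complex_cnj_mult)
  hence "cnj c = c" using \<open>S > 0\<close> by simp
  thus ?thesis by (simp add: Reals_cnj_iff)
qed

text \<open>Over the complex numbers the polynomial splits, and every root is an eigenvalue, hence
  real. The full list of roots is carried back to the reals, so multiplicities survive.\<close>

lemma char_poly_symmetric_factorized:
  fixes A :: "real mat"
  assumes A: "A \<in> carrier_mat n n" and sym: "transpose_mat A = A"
  shows "\<exists>es. length es = n \<and> char_poly A = (\<Prod>e\<leftarrow>es. [:- e, 1:])"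
proof -
  let ?A = "map_mat complex_of_real A"
  have cA: "?A \<in> carrier_mat n n" using A by auto
  obtain as where as: "char_poly ?A = (\<Prod>a\<leftarrow>as. [:- a, 1:])" "length as = n"
    using char_poly_factorized[OF cA] by auto
  have real: "a \<in> \<real>" if "a \<in> set as" for a
  proof (rule eigenvalue_symmetric_real[OF A sym])
    have "poly (char_poly ?A) a = 0"
      unfolding as(1) using that by (induction as) auto
    thus "eigenvalue ?A a" using eigenvalue_root_char_poly[OF cA] by simp
  qed
  define es where "es = map Re as"
  have es: "as = map of_real es"
    unfolding es_def using real by (induction as) (auto simp: of_real_Re)
  have "map_poly complex_of_real (char_poly A) = char_poly ?A"
    by (simp add: of_real_hom.char_poly_hom[OF A])
  also have "\<dots> = (\<Prod>e\<leftarrow>es. [:- of_real e, 1:])" unfolding as(1) es by (simp add: o_def)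
  also have "\<dots> = map_poly complex_of_real (\<Prod>e\<leftarrow>es. [:- e, 1:])"
  proof -
    interpret h: map_poly_comm_ring_hom "of_real :: real \<Rightarrow> complex" ..
    have "[:- complex_of_real e, 1:] = map_poly complex_of_real [:- e, 1:]" for e
      by (simp add: map_poly_pCons)
    thus ?thesis by (induction es) (simp_all only: list.map prod_list.Nil prod_list.Cons h.hom_mult h.hom_one)
  qed
  finally have eq: "map_poly complex_of_real (char_poly A) = map_poly complex_of_real (\<Prod>e\<leftarrow>es. [:- e, 1:])" .
  have "char_poly A = (\<Prod>e\<leftarrow>es. [:- e, 1:])"
  proof (rule poly_eqI)
    fix i
    show "coeff (char_poly A) i = coeff (\<Prod>e\<leftarrow>es. [:- e, 1:]) i"
      using arg_cong[OF eq, of "\<lambda>p. coeff p i"] by (simp add: coeff_map_poly)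
  qed
  thus ?thesis using as(2) es by (intro exI[of _ es]) auto
qed

text \<open>The reflection along \<open>x - e_0\<close> exchanges \<open>e_0\<close> and
  \<open>x\<close>. It supplies an orthogonal matrix with prescribed first column that is its own
  transpose and inverse, so no orthonormal basis has to be completed.\<close>

lemma householder:
  fixes x :: "nat \<Rightarrow> real"
  assumes n: "n > 0" and unit: "(\<Sum>s<n. (x s)\<^sup>2) = 1"
  shows "\<exists>H \<in> carrier_mat n n. transpose_mat H = H \<and> H * H = 1\<^sub>m n \<and> (\<forall>s<n. H $$ (s,0) = x s)"
proof -
  define w where "w s = x s - (if s = 0 then 1 else 0)" for s
  define S where "S = (\<Sum>s<n. (w s)\<^sup>2)"
  \<comment> \<open>If \<open>x\<close> is the unit vector \<open>e\<^sub>0\<close>, then \<open>S = 0\<close>, so \<open>c = 2 / 0 = 0\<close> and \<open>H\<close> is the identity, as it should be.\<close>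
  define c where "c = 2 / S"
  define H where "H = Matrix.mat n n (\<lambda>(s,t). (if s = t then 1 else 0) - c * w s * w t)"
  have S: "S = 2 - 2 * x 0"
  proof -
    have "S = (\<Sum>s<n. (x s)\<^sup>2 + (if s = 0 then 1 - 2 * x 0 else 0))"
      unfolding S_def w_def by (intro sum.cong) (auto simp: power2_eq_square algebra_simps)
    also have "\<dots> = 2 - 2 * x 0" using n unit by (simp add: sum.distrib sum.delta)
    finally show ?thesis .
  qed
  have H: "H \<in> carrier_mat n n" unfolding H_def by auto
  have "transpose_mat H = H" unfolding H_def by (auto simp: Matrix.transpose_mat_def)
  moreover have "H * H = 1\<^sub>m n"
  proof (rule eq_matI)
    fix s t assume "s < dim_row (1\<^sub>m n :: real mat)" "t < dim_col (1\<^sub>m n :: real mat)"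
    hence st: "s < n" "t < n" by auto
    have "(H * H) $$ (s,t) = (\<Sum>l<n. ((if s = l then 1 else 0) - c * w s * w l) * ((if l = t then 1 else 0) - c * w l * w t))"
      using st H by (auto simp: scalar_prod_def H_def lessThan_atLeast0)
    also have "\<dots> = (\<Sum>l<n. (if l = s then (if l = t then 1 else 0) - c * w l * w t else 0) 
        + (if l = t then - (c * w s * w l) else 0) + c * c * w s * w t * (w l)\<^sup>2)"
      by (intro sum.cong) (auto simp: algebra_simps power2_eq_square)
    also have "\<dots> = (if s = t then 1 else 0) - 2 * c * w s * w t + c * c * w s * w t * S"
      using st unfolding S_def by (simp add: sum.distrib sum.delta sum_distrib_left)
    also have "\<dots> = (if s = t then 1 else 0)"
      by (cases "S = 0") (auto simp: c_def)
    finally show "(H * H) $$ (s,t) = 1\<^sub>m n $$ (s,t)" using st by auto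
  qed (use H in auto)
  moreover have "H $$ (s,0) = x s" if s: "s < n" for s
  proof (cases "S = 0")
    case True
    hence "w s = 0" using s unfolding S_def by (subst (asm) sum_nonneg_eq_0_iff) auto
    thus ?thesis using s n unfolding H_def w_def by auto
  next
    case False
    hence "c * w 0 = -1" unfolding c_def w_def S by (simp add: field_simps)
    hence "c * w s * w 0 = - w s" by (metis mult.assoc mult.commute mult_minus_left mult_1)
    thus ?thesis using s n unfolding H_def by (auto simp: w_def)
  qed
  ultimately show ?thesis using H by blast
qed

lemma real_eigenvector_unit:
  fixes A :: "real mat"
  assumes A: "A \<in> carrier_mat n n" and ev: "eigenvalue A e"
  shows "\<exists>x. (\<Sum>s<n. (x s)\<^sup>2) = 1 \<and> (\<forall>s<n. (\<Sum>t<n. A $$ (s,t) * x t) = e * x s)"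
proof -
  from ev obtain v where v: "v \<in> carrier_vec n" and v0: "v \<noteq> 0\<^sub>v n" and
    Av: "A *\<^sub>v v = e \<cdot>\<^sub>v v"
    using A unfolding eigenvalue_def eigenvector_def by auto
  define S where "S = (\<Sum>s<n. (vec_index v s)\<^sup>2)"
  from v0 v obtain s where s: "s < n" "vec_index v s \<noteq> 0" by (auto simp: vec_eq_iff)
  have S: "S > 0" unfolding S_def by (rule sum_pos2[of _ s]) (use s in auto)
  define x where "x s = vec_index v s / sqrt S" for s
  have "(\<Sum>s<n. (x s)\<^sup>2) = 1"
    unfolding x_def using S by (simp add: power_divide flip: sum_divide_distrib S_def)
  moreover have "(\<Sum>t<n. A $$ (s,t) * x t) = e * x s" if "s < n" for s
  proof -
    have "vec_index (A *\<^sub>v v) s = (\<Sum>t<n. A $$ (s,t) * vec_index v t)"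
      using that A v by (auto simp: scalar_prod_def lessThan_atLeast0)
    hence "(\<Sum>t<n. A $$ (s,t) * vec_index v t) = e * vec_index v s"
      unfolding Av using that v by auto
    thus ?thesis unfolding x_def by (simp flip: sum_divide_distrib)
  qed
  ultimately show ?thesis by blast
qed

text \<open>Deflation: a reflection carrying \<open>e_0\<close> to a unit eigenvector turns
  \<open>A\<close> into a block matrix with the eigenvalue in the corner and a smaller symmetric
  block, to which induction applies. The order of \<open>es\<close> is arbitrary, so the eigenvalues
  can later be listed in decreasing order.\<close>

lemma symmetric_diagonalization:
  fixes A :: "real mat"
  assumes "A \<in> carrier_mat n n" "transpose_mat A = A" "char_poly A = (\<Prod>e\<leftarrow>es. [:- e, 1:])"
  shows "\<exists>U \<in> carrier_mat n n. transpose_mat U * U = 1\<^sub>m n \<and>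
           A = U * mat_diag n (nth es) * transpose_mat U"
  using assms
proof (induction es arbitrary: A n)
  case Nil
  hence "n = 0" using degree_monic_char_poly[OF Nil(1)] by auto
  thus ?case using Nil by (intro bexI[of _ A]) auto
next
  case (Cons e es A n)
  have A: "A \<in> carrier_mat n n" by fact
  have "degree (char_poly A) = length (e # es)"
    unfolding Cons.prems(3) by (rule degree_linear_factors)
  then obtain m where n: "n = Suc m" and m: "m = length es" using degree_monic_char_poly[OF A] by auto
  have "eigenvalue A e" unfolding eigenvalue_root_char_poly[OF A] Cons.prems(3) by simp
  from real_eigenvector_unit[OF A this] obtain x where
    x: "(\<Sum>s<n. (x s)\<^sup>2) = 1" "\<And>s. s < n \<Longrightarrow> (\<Sum>t<n. A $$ (s,t) * x t) = e * x s" by auto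
  obtain H where H: "H \<in> carrier_mat n n" "transpose_mat H = H" "H * H = 1\<^sub>m n"
    and Hx: "\<And>s. s < n \<Longrightarrow> H $$ (s,0) = x s"
    using householder[OF _ x(1)] n by auto
  define B where "B = H * A * H"
  have B: "B \<in> carrier_mat n n" unfolding B_def using H A by auto
  have symB: "transpose_mat B = B"
    unfolding B_def using H A Cons.prems(2)
    by (simp add: transpose_mult[of _ n n _ n] assoc_mult_mat[of _ n n _ n _ n])
  have AHB: "A = H * B * H"
  proof -
    have "H * B * H = (H * H) * A * (H * H)"
      unfolding B_def using H(1) A by (simp add: assoc_mult_mat[of _ n n _ n _ n])
    thus ?thesis using A H(3) by simp
  qed
  \<comment> \<open>Column 0 of \<open>A * H\<close> is \<open>A\<close> applied to the eigenvector,
    that is \<open>e\<close> times column 0 of \<open>H\<close>; the outer \<open>H\<close> then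
    sends it to \<open>e\<close> times column 0 of \<open>H * H\<close>. Symmetry clears row 0 as
    well.\<close>
  have col0: "B $$ (s,0) = (if s = 0 then e else 0)" if s: "s < n" for s
  proof -
    have AH: "(A * H) $$ (t,0) = e * H $$ (t,0)" if "t < n" for t
      using that n A H(1) x(2)[OF that] Hx by (auto simp: scalar_prod_def lessThan_atLeast0)
    have "B = H * (A * H)" unfolding B_def using H A by (simp add: assoc_mult_mat[of _ n n _ n _ n])
    hence "B $$ (s,0) = (\<Sum>t<n. H $$ (s,t) * (A * H) $$ (t,0))"
      using s n A H(1) by (auto simp: scalar_prod_def lessThan_atLeast0)
    also have "\<dots> = e * (\<Sum>t<n. H $$ (s,t) * H $$ (t,0))"
      by (simp add: AH sum_distrib_left mult.left_commute)
    also have "(\<Sum>t<n. H $$ (s,t) * H $$ (t,0)) = (H * H) $$ (s,0)"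
      using s n H(1) by (auto simp: scalar_prod_def lessThan_atLeast0)
    finally show ?thesis using s n unfolding H(3) by auto
  qed
  define E where "E = Matrix.mat 1 1 (\<lambda>_. e)"
  define C where "C = Matrix.mat m m (\<lambda>(s,t). B $$ (Suc s, Suc t))"
  have E: "E \<in> carrier_mat 1 1" and C: "C \<in> carrier_mat m m" unfolding E_def C_def by auto
  have symB': "B $$ (s,t) = B $$ (t,s)" if "s < n" "t < n" for s t
    using arg_cong[OF symB, of "\<lambda>B. B $$ (s,t)"] B that by auto
  have Bblock: "B = four_block_mat E (0\<^sub>m 1 m) (0\<^sub>m m 1) C"
    by (rule eq_matI) (use B n symB' col0 in \<open>auto simp: E_def C_def\<close>)
  have symC: "transpose_mat C = C"
    by (rule eq_matI) (use symB' n in \<open>auto simp: C_def\<close>)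
  have "similar_mat A B"
    by (rule similar_matI[where n = n and P = H and Q = H]) (use A B H AHB in auto)
  hence "char_poly A = char_poly B" by (rule char_poly_similar)
  also have "\<dots> = char_poly E * char_poly C"
    unfolding Bblock by (rule char_poly_four_block_zeros_col[OF E _ C]) auto
  also have "char_poly E = [:- e, 1:]"
    by (subst char_poly_upper_triangular[OF E]) (auto simp: E_def diag_mat_def)
  finally have "[:- e, 1:] * (\<Prod>e\<leftarrow>es. [:- e, 1:]) = [:- e, 1:] * char_poly C"
    unfolding Cons.prems(3) by simp
  hence cpC: "char_poly C = (\<Prod>e\<leftarrow>es. [:- e, 1:])"
    by (metis mult_left_cancel pCons_eq_0_iff zero_neq_one)
  from Cons.IH[OF C symC cpC] obtain V where V: "V \<in> carrier_mat m m"
    and VV: "transpose_mat V * V = 1\<^sub>m m" and CV: "C = V * mat_diag m (nth es) * transpose_mat V" by auto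
  define W where "W = four_block_mat (1\<^sub>m 1) (0\<^sub>m 1 m) (0\<^sub>m m 1) V"
  have W: "W \<in> carrier_mat n n" unfolding W_def n using V by auto
  have WT: "transpose_mat W = four_block_mat (1\<^sub>m 1) (0\<^sub>m 1 m) (0\<^sub>m m 1) (transpose_mat V)"
    unfolding W_def using V by (subst transpose_four_block_mat[of _ 1 1 _ m _ m]) auto
  have VT: "transpose_mat V \<in> carrier_mat m m" using V by auto
  have D: "mat_diag n (nth (e # es)) = four_block_mat E (0\<^sub>m 1 m) (0\<^sub>m m 1) (mat_diag m (nth es))"
    unfolding n by (rule eq_matI) (auto simp: mat_diag_def E_def nth_Cons' )
  have WW: "transpose_mat W * W = 1\<^sub>m n"
    unfolding WT unfolding W_def n
    using V VT VV by (subst mult_four_block_mat[of _ 1 1 _ m _ m _ _ 1 _ m]) auto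
  have dm: "mat_diag m (nth es) \<in> carrier_mat m m" by simp
  have "W * mat_diag n (nth (e # es)) * transpose_mat W = B"
  proof -
    have "W * mat_diag n (nth (e # es)) = four_block_mat E (0\<^sub>m 1 m) (0\<^sub>m m 1) (V * mat_diag m (nth es))"
      unfolding D W_def using V E dm left_mult_zero_mat[OF dm, of 1]
      by (subst mult_four_block_mat[of _ 1 1 _ m _ m _ _ 1 _ m]) auto
    moreover have "V * mat_diag m (nth es) \<in> carrier_mat m m" using V dm by (rule mult_carrier_mat)
    moreover from this have "V * mat_diag m (nth es) * 0\<^sub>m m 1 = 0\<^sub>m m 1"
      by (rule right_mult_zero_mat)
    moreover have "V * mat_diag m (nth es) * transpose_mat V \<in> carrier_mat m m"
      by (intro mult_carrier_mat[of _ m m] V dm VT)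
    ultimately show ?thesis
      unfolding WT Bblock CV using VT E
      by (simp, subst mult_four_block_mat[of _ 1 1 _ m _ m _ _ 1 _ m]) auto
  qed
  note BW = this[symmetric]
  define U where "U = H * W"
  have U: "U \<in> carrier_mat n n" unfolding U_def using H W by auto
  have UT: "transpose_mat U = transpose_mat W * H" unfolding U_def
    using transpose_mult[OF H(1) W] H(2) by simp
  have WTc: "transpose_mat W \<in> carrier_mat n n" using W by auto
  have "transpose_mat U * U = transpose_mat W * (H * H) * W"
    unfolding UT unfolding U_def using H(1) W WTc by (simp add: assoc_mult_mat[of _ n n _ n _ n])
  hence "transpose_mat U * U = 1\<^sub>m n" using H(3) W WTc WW by simp
  moreover have "A = U * mat_diag n (nth (e # es)) * transpose_mat U"
    unfolding UT unfolding U_def AHB BW using H(1) W WTc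
    by (simp add: assoc_mult_mat[of _ n n _ n _ n] mult_carrier_mat[of _ n n _ n])
  ultimately show ?case using U by blast
qed

lemma symmetric_spectral:
  fixes A :: "real mat"
  assumes A: "A \<in> carrier_mat n n" and sym: "transpose_mat A = A"
  shows "\<exists>u. (\<forall>i<n. \<forall>j<n. (\<Sum>t<n. u i t * u j t) = (if i = j then 1 else (0::real))) \<and>
             (\<forall>s<n. \<forall>t<n. (\<Sum>j<n. u j s * u j t) = (if s = t then 1 else 0)) \<and>
             (\<forall>s<n. \<forall>t<n. A $$ (s,t) = (\<Sum>j<n. eigval (Suc j) A * u j s * u j t))"
    and "\<And>i j. i \<le> j \<Longrightarrow> j < n \<Longrightarrow> eigval (Suc j) A \<le> eigval (Suc i) A"
proof -
  obtain bs where bs: "length bs = n" "char_poly A = (\<Prod>e\<leftarrow>bs. [:- e, 1:])"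
    using char_poly_symmetric_factorized[OF A sym] by auto
  define es where "es = rev (sort bs)"
  have pr: "proots (\<Prod>e\<leftarrow>bs. [:- e, 1:]) = mset bs"
  proof (induction bs)
    case (Cons b bs)
    have "(\<Prod>e\<leftarrow>bs. [:- e, 1:]) \<noteq> 0" by (auto simp: prod_list_zero_iff)
    thus ?case using Cons by (simp add: proots_mult del: mult_pCons_left)
  qed simp
  have es: "rev (sorted_list_of_multiset (proots (char_poly A))) = es"
    unfolding bs(2) pr es_def by simp
  have len: "length es = n" unfolding es_def using bs by simp
  have ev: "eigval (Suc j) A = es ! j" for j
    unfolding eigval_def es by simp
  \<comment> \<open>Only the multiset of roots enters the product, so the diagonalization may be run
    on the decreasingly sorted list that \<open>eigval\<close> reads.\<close>
  have "mset es = mset bs" unfolding es_def by simp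
  hence cp: "char_poly A = (\<Prod>e\<leftarrow>es. [:- e, 1:])"
    unfolding bs(2) by (metis mset_map prod_mset_prod_list)
  from symmetric_diagonalization[OF A sym cp] obtain U where U: "U \<in> carrier_mat n n"
    and UU: "transpose_mat U * U = 1\<^sub>m n" and AU: "A = U * mat_diag n (nth es) * transpose_mat U" by auto
  have UU': "U * transpose_mat U = 1\<^sub>m n"
    by (rule mat_mult_left_right_inverse[OF _ U UU]) (use U in auto)
  have 1: "(\<Sum>t<n. U $$ (t,i) * U $$ (t,j)) = (if i = j then 1 else 0)" if "i < n" "j < n" for i j
    using arg_cong[OF UU, of "\<lambda>B. B $$ (i,j)"] U that by (auto simp: scalar_prod_def lessThan_atLeast0)
  have 2: "(\<Sum>t<n. U $$ (i,t) * U $$ (j,t)) = (if i = j then 1 else 0)" if "i < n" "j < n" for i j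
    using arg_cong[OF UU', of "\<lambda>B. B $$ (i,j)"] U that by (auto simp: scalar_prod_def lessThan_atLeast0)
  have 3: "A $$ (s,t) = (\<Sum>j<n. es ! j * U $$ (s,j) * U $$ (t,j))" if "s < n" "t < n" for s t
  proof -
    have "A $$ (s,t) = (U * mat_diag n (nth es) * transpose_mat U) $$ (s,t)" using AU by simp
    also have "\<dots> = (\<Sum>j<n. es ! j * U $$ (s,j) * U $$ (t,j))"
      using that U unfolding mat_diag_mult_right[OF U]
      by (auto simp: scalar_prod_def lessThan_atLeast0 mult_ac)
    finally show ?thesis .
  qed
  show "\<exists>u. (\<forall>i<n. \<forall>j<n. (\<Sum>t<n. u i t * u j t) = (if i = j then 1 else (0::real))) \<and>
             (\<forall>s<n. \<forall>t<n. (\<Sum>j<n. u j s * u j t) = (if s = t then 1 else 0)) \<and>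
             (\<forall>s<n. \<forall>t<n. A $$ (s,t) = (\<Sum>j<n. eigval (Suc j) A * u j s * u j t))"
    by (rule exI[of _ "\<lambda>j t. U $$ (t,j)"]) (use 1 2 3 in \<open>auto simp: ev\<close>)
  show "eigval (Suc j) A \<le> eigval (Suc i) A" if "i \<le> j" "j < n" for i j
  proof -
    have "sorted (rev es)" unfolding es_def by simp
    thus ?thesis unfolding ev using that len
      by (simp add: es_def rev_nth sorted_nth_mono)
  qed
qed

section \<open>Min-max estimates for eigenvalues\<close>

text \<open>Vectors are plain functions read only below \<open>n\<close>; linear combinations then
  need no carrier conditions.\<close>

definition dot :: "nat \<Rightarrow> (nat \<Rightarrow> real) \<Rightarrow> (nat \<Rightarrow> real) \<Rightarrow> real" where
  "dot n x y = (\<Sum>s<n. x s * y s)"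

definition quad :: "nat \<Rightarrow> (nat \<Rightarrow> nat \<Rightarrow> real) \<Rightarrow> (nat \<Rightarrow> real) \<Rightarrow> real" where
  "quad n a x = (\<Sum>s<n. \<Sum>t<n. a s t * x s * x t)"

lemma dot_nonneg: "dot n x x \<ge> 0"
  unfolding dot_def by (intro sum_nonneg) auto

lemma dot_commute: "dot n x y = dot n y x"
  unfolding dot_def by (simp add: mult.commute)

lemma dot_sum_left: "dot n (\<lambda>s. \<Sum>l\<in>L. c l * v l s) y = (\<Sum>l\<in>L. c l * dot n (v l) y)"
proof -
  have "dot n (\<lambda>s. \<Sum>l\<in>L. c l * v l s) y = (\<Sum>s<n. \<Sum>l\<in>L. c l * (v l s * y s))"
    unfolding dot_def by (simp add: sum_distrib_right mult.assoc)
  also have "\<dots> = (\<Sum>l\<in>L. c l * dot n (v l) y)"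
    unfolding dot_def sum_distrib_left by (rule sum.swap)
  finally show ?thesis .
qed

lemma dot_sum_right: "dot n y (\<lambda>s. \<Sum>l\<in>L. c l * v l s) = (\<Sum>l\<in>L. c l * dot n y (v l))"
  by (subst (1 2) dot_commute) (rule dot_sum_left)

lemma dot_Cauchy_Schwarz: "(dot n x y)\<^sup>2 \<le> dot n x x * dot n y y"
  unfolding dot_def using Cauchy_Schwarz_ineq_sum[of x y "{..<n}"] by (simp add: power2_eq_square)

lemma quad_rank_one_sum:
  "quad n (\<lambda>s t. \<Sum>j\<in>J. e j * v j s * v j t) x = (\<Sum>j\<in>J. e j * (dot n (v j) x)\<^sup>2)"
proof -
  have "quad n (\<lambda>s t. \<Sum>j\<in>J. e j * v j s * v j t) x
      = (\<Sum>s<n. \<Sum>j\<in>J. \<Sum>t<n. e j * (v j s * x s) * (v j t * x t))"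
    unfolding quad_def
    by (intro sum.cong refl, subst sum.swap) (simp add: sum_distrib_left sum_distrib_right mult_ac)
  also have "\<dots> = (\<Sum>j\<in>J. \<Sum>s<n. \<Sum>t<n. e j * (v j s * x s) * (v j t * x t))"
    by (rule sum.swap)
  also have "\<dots> = (\<Sum>j\<in>J. e j * (dot n (v j) x)\<^sup>2)"
    unfolding dot_def power2_eq_square
    by (intro sum.cong refl, subst sum_product) (simp add: sum_distrib_left mult_ac)
  finally show ?thesis .
qed

lemma quad_cong: "(\<And>s t. s < n \<Longrightarrow> t < n \<Longrightarrow> a s t = b s t) \<Longrightarrow> quad n a x = quad n b x"
  unfolding quad_def by (intro sum.cong) auto

lemma quad_identity: "quad n (\<lambda>s t. if s = t then 1 else 0) x = dot n x x"
  unfolding quad_def dot_def by (simp add: if_distrib[of "\<lambda>z. z * _"] sum.delta cong: if_cong)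

lemma quad_scale: "quad n (\<lambda>s t. c * a s t) x = c * quad n a x"
  unfolding quad_def by (simp add: sum_distrib_left mult.assoc)

lemma quad_diff: "quad n (\<lambda>s t. a s t - b s t) x = quad n a x - quad n b x"
  unfolding quad_def by (simp add: left_diff_distrib sum_subtractf)

text \<open>Orthonormality, resolution of the identity (which yields Parseval), and the spectral
  decomposition. The vector \<open>u j\<close> belongs to the eigenvalue counted
  \<open>Suc j\<close>, since frames start at 0 and \<open>eigval\<close> at 1.\<close>

definition eigenframe :: "nat \<Rightarrow> real mat \<Rightarrow> (nat \<Rightarrow> nat \<Rightarrow> real) \<Rightarrow> bool" where
  "eigenframe n A u \<longleftrightarrow>
     (\<forall>i<n. \<forall>j<n. dot n (u i) (u j) = (if i = j then 1 else 0)) \<and>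
     (\<forall>s<n. \<forall>t<n. (\<Sum>j<n. u j s * u j t) = (if s = t then 1 else 0)) \<and>
     (\<forall>s<n. \<forall>t<n. A $$ (s,t) = (\<Sum>j<n. eigval (Suc j) A * u j s * u j t))"

lemma eigenframe_exists:
  assumes "A \<in> carrier_mat n n" "transpose_mat A = A"
  obtains u where "eigenframe n A u"
  using symmetric_spectral(1)[OF assms] unfolding eigenframe_def dot_def by blast

lemma eigenframe_orthonormal:
  assumes "eigenframe n A u" "i < n" "j < n"
  shows "dot n (u i) (u j) = (if i = j then 1 else 0)"
  using assms unfolding eigenframe_def by blast

lemma eigenframe_quad:
  assumes "eigenframe n A u"
  shows "quad n (\<lambda>s t. A $$ (s,t)) x = (\<Sum>j<n. eigval (Suc j) A * (dot n (u j) x)\<^sup>2)"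
  unfolding quad_rank_one_sum[symmetric] by (rule quad_cong) (use assms in \<open>auto simp: eigenframe_def\<close>)

lemma eigenframe_Parseval:
  assumes "eigenframe n A u"
  shows "dot n x x = (\<Sum>j<n. (dot n (u j) x)\<^sup>2)"
proof -
  have "dot n x x = quad n (\<lambda>s t. \<Sum>j<n. 1 * u j s * u j t) x"
    unfolding quad_identity[symmetric] by (rule quad_cong) (use assms in \<open>auto simp: eigenframe_def\<close>)
  thus ?thesis unfolding quad_rank_one_sum by simp
qed

text \<open>The dimension count behind min-max: \<open>m\<close> homogeneous equations in
  \<open>m + 1\<close> unknowns. A zero row makes the coefficient matrix square and
  singular.\<close>

lemma underdetermined_solution:
  fixes g :: "nat \<Rightarrow> nat \<Rightarrow> real"
  obtains c where "\<exists>l\<le>m. c l \<noteq> 0" "\<And>j. j < m \<Longrightarrow> (\<Sum>l\<le>m. c l * g j l) = 0"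
proof -
  define G where "G = Matrix.mat (Suc m) (Suc m) (\<lambda>(j,l). if j < m then g j l else 0)"
  have G: "G \<in> carrier_mat (Suc m) (Suc m)" unfolding G_def by auto
  have "det G = (\<Sum>j<Suc m. G $$ (m,j) * cofactor G m j)"
    by (rule laplace_expansion_row[OF G]) simp
  also have "\<dots> = 0" by (rule sum.neutral) (auto simp: G_def)
  finally have "det G = 0" .
  then obtain v where v: "v \<in> carrier_vec (Suc m)" "v \<noteq> 0\<^sub>v (Suc m)" "G *\<^sub>v v = 0\<^sub>v (Suc m)"
    using det_0_iff_vec_prod_zero[OF G] by auto
  show thesis
  proof (rule that[of "vec_index v"])
    show "\<exists>l\<le>m. vec_index v l \<noteq> 0" using v(1,2) by (auto simp: vec_eq_iff less_Suc_eq_le)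
    fix j assume j: "j < m"
    have "vec_index (G *\<^sub>v v) j = (\<Sum>l<Suc m. g j l * vec_index v l)"
      using j v(1) G by (auto simp: scalar_prod_def lessThan_atLeast0 G_def)
    thus "(\<Sum>l\<le>m. vec_index v l * g j l) = 0"
      using v(3) j by (simp add: mult.commute flip: lessThan_Suc_atMost)
  qed
qed

text \<open>Some nonzero combination of the \<open>i + 1\<close> vectors \<open>v l\<close> is
  orthogonal to the top \<open>i\<close> eigenvectors, so its Rayleigh quotient is at most
  \<open>eigval (Suc i) A\<close>. The positivity demanded in \<open>ray\<close> stands in for
  linear independence of the \<open>v l\<close>.\<close>

lemma eigval_ge:
  fixes A :: "real mat"
  assumes A: "A \<in> carrier_mat n n" and sym: "transpose_mat A = A" and i: "i < n"
    and ray: "\<And>c x. \<exists>l\<le>i. c l \<noteq> 0 \<Longrightarrow> x = (\<lambda>s. \<Sum>l\<le>i. c l * v l s) \<Longrightarrow>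
       dot n x x > 0 \<and> t * dot n x x \<le> quad n (\<lambda>s t. A $$ (s,t)) x"
  shows "t \<le> eigval (Suc i) A"
proof -
  obtain u where "eigenframe n A u" using eigenframe_exists[OF A sym] .
  note u = eigenframe_Parseval[OF this] eigenframe_quad[OF this]
  obtain c where c: "\<exists>l\<le>i. c l \<noteq> 0" "\<And>j. j < i \<Longrightarrow> (\<Sum>l\<le>i. c l * dot n (u j) (v l)) = 0"
    by (rule underdetermined_solution[of i "\<lambda>j l. dot n (u j) (v l)"]) blast
  define x where "x = (\<lambda>s. \<Sum>l\<le>i. c l * v l s)"
  have x0: "dot n (u j) x = 0" if "j < i" for j
    unfolding x_def dot_sum_right using c(2)[OF that] .
  have "quad n (\<lambda>s t. A $$ (s,t)) x \<le> (\<Sum>j<n. eigval (Suc i) A * (dot n (u j) x)\<^sup>2)"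
    unfolding u(2)
  proof (intro sum_mono)
    fix j assume "j \<in> {..<n}"
    thus "eigval (Suc j) A * (dot n (u j) x)\<^sup>2 \<le> eigval (Suc i) A * (dot n (u j) x)\<^sup>2"
      using x0[of j] symmetric_spectral(2)[OF A sym, of i j]
      by (cases "j < i") (auto intro!: mult_right_mono)
  qed
  also have "\<dots> = eigval (Suc i) A * dot n x x" unfolding u(1)[of x] sum_distrib_left ..
  finally have "t * dot n x x \<le> eigval (Suc i) A * dot n x x"
    using ray[OF c(1) x_def] by linarith
  thus ?thesis using ray[OF c(1) x_def] by simp
qed

text \<open>The dual count: among combinations of the top \<open>i + 1\<close> eigenvectors one is
  orthogonal to all \<open>i\<close> constraints \<open>v l\<close>, and its Rayleigh quotient is at
  least the eigenvalue. The \<open>v l\<close> may be arbitrary, even dependent.\<close>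

lemma eigval_le:
  fixes A :: "real mat"
  assumes A: "A \<in> carrier_mat n n" and sym: "transpose_mat A = A" and i: "i < n"
    and ray: "\<And>x. (\<And>l. l < i \<Longrightarrow> dot n (v l) x = 0) \<Longrightarrow> quad n (\<lambda>s t. A $$ (s,t)) x \<le> t * dot n x x"
  shows "eigval (Suc i) A \<le> t"
proof -
  obtain u where "eigenframe n A u" using eigenframe_exists[OF A sym] .
  note u = eigenframe_Parseval[OF this] eigenframe_quad[OF this] eigenframe_orthonormal[OF this]
  obtain c where c: "\<exists>l\<le>i. c l \<noteq> 0" "\<And>j. j < i \<Longrightarrow> (\<Sum>l\<le>i. c l * dot n (v j) (u l)) = 0"
    by (rule underdetermined_solution[of i "\<lambda>j l. dot n (v j) (u l)"]) blast
  define x where "x = (\<lambda>s. \<Sum>l\<le>i. c l * u l s)"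
  have ux: "dot n (u j) x = (if j \<le> i then c j else 0)" if "j < n" for j
  proof -
    have "dot n (u j) x = (\<Sum>l\<le>i. if l = j then c l else 0)"
      unfolding x_def dot_sum_right using that i by (intro sum.cong) (auto simp: u(3))
    thus ?thesis by simp
  qed
  from c(1) obtain l where l: "l \<le> i" "c l \<noteq> 0" by auto
  have pos: "dot n x x > 0"
    unfolding u(1) by (rule sum_pos2[of _ l]) (use l i ux[of l] in auto)
  have "eigval (Suc i) A * dot n x x = (\<Sum>j<n. eigval (Suc i) A * (dot n (u j) x)\<^sup>2)"
    unfolding u(1)[of x] sum_distrib_left ..
  also have "\<dots> \<le> quad n (\<lambda>s t. A $$ (s,t)) x"
    unfolding u(2)
  proof (intro sum_mono)
    fix j assume "j \<in> {..<n}"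
    thus "eigval (Suc i) A * (dot n (u j) x)\<^sup>2 \<le> eigval (Suc j) A * (dot n (u j) x)\<^sup>2"
      using ux[of j] i symmetric_spectral(2)[OF A sym, of j i]
      by (cases "j \<le> i") (auto intro!: mult_right_mono)
  qed
  also have "\<dots> \<le> t * dot n x x"
    by (rule ray) (simp add: x_def dot_sum_right c(2))
  finally show ?thesis using pos by simp
qed

text \<open>One half of Weyl's inequality: the leading eigenvectors of \<open>B\<close> serve as the
  constraints for \<open>A\<close>.\<close>

lemma eigval_le_perturb:
  fixes A B :: "real mat"
  assumes A: "A \<in> carrier_mat n n" "transpose_mat A = A" and B: "B \<in> carrier_mat n n" "transpose_mat B = B"
    and i: "i < n"
    and d: "\<And>x. quad n (\<lambda>s t. A $$ (s,t)) x - quad n (\<lambda>s t. B $$ (s,t)) x \<le> d * dot n x x"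
  shows "eigval (Suc i) A \<le> eigval (Suc i) B + d"
proof -
  obtain u where "eigenframe n B u" using eigenframe_exists[OF B] .
  note u = eigenframe_Parseval[OF this] eigenframe_quad[OF this]
  show ?thesis
  proof (rule eigval_le[OF A i, of u])
    fix x assume x: "\<And>l. l < i \<Longrightarrow> dot n (u l) x = 0"
    have "quad n (\<lambda>s t. B $$ (s,t)) x \<le> (\<Sum>j<n. eigval (Suc i) B * (dot n (u j) x)\<^sup>2)"
      unfolding u(2)
    proof (intro sum_mono)
      fix j assume "j \<in> {..<n}"
      thus "eigval (Suc j) B * (dot n (u j) x)\<^sup>2 \<le> eigval (Suc i) B * (dot n (u j) x)\<^sup>2"
        using x[of j] symmetric_spectral(2)[OF B, of i j]
        by (cases "j < i") (auto intro!: mult_right_mono)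
    qed
    also have "\<dots> = eigval (Suc i) B * dot n x x" unfolding u(1)[of x] sum_distrib_left ..
    finally show "quad n (\<lambda>s t. A $$ (s,t)) x \<le> (eigval (Suc i) B + d) * dot n x x"
      using d[of x] by (simp add: distrib_right)
  qed
qed

lemma quad_le_entries:
  assumes "\<And>s t. s < n \<Longrightarrow> t < n \<Longrightarrow> \<bar>a s t\<bar> \<le> d"
  shows "quad n a x \<le> (real n * d) * dot n x x"
proof (cases "n = 0")
  case False
  \<comment> \<open>Nonnegativity of \<open>d\<close> is read off an actual entry, which is why
    \<open>n = 0\<close> is split off.\<close>
  hence d: "d \<ge> 0" using assms[of 0 0] by auto
  have "quad n a x \<le> (\<Sum>s<n. \<Sum>t<n. d * (\<bar>x s\<bar> * \<bar>x t\<bar>))"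
    unfolding quad_def
  proof (intro sum_mono)
    fix s t assume "s \<in> {..<n}" "t \<in> {..<n}"
    hence "\<bar>a s t * x s * x t\<bar> \<le> d * (\<bar>x s\<bar> * \<bar>x t\<bar>)"
      using assms[of s t] by (simp add: abs_mult mult_right_mono mult.assoc)
    thus "a s t * x s * x t \<le> d * (\<bar>x s\<bar> * \<bar>x t\<bar>)" by linarith
  qed
  also have "\<dots> = d * (\<Sum>s<n. \<bar>x s\<bar>)\<^sup>2"
    unfolding power2_eq_square sum_product by (simp add: sum_distrib_left)
  finally have le: "quad n a x \<le> d * (\<Sum>s<n. \<bar>x s\<bar>)\<^sup>2" .
  have "(\<Sum>s<n. \<bar>x s\<bar>)\<^sup>2 \<le> real n * dot n x x"
    using Cauchy_Schwarz_ineq_sum[of "\<lambda>_. 1" "\<lambda>s. \<bar>x s\<bar>" "{..<n}"] unfolding dot_def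
    by (simp add: power2_eq_square)
  hence "d * (\<Sum>s<n. \<bar>x s\<bar>)\<^sup>2 \<le> d * (real n * dot n x x)" using d by (rule mult_left_mono)
  thus ?thesis using le by (simp add: mult_ac)
qed (simp add: quad_def)

text \<open>Used for continuity of eigenvalues in the entries at fixed \<open>n\<close>, where the
  crude factor \<open>n\<close> does no harm.\<close>

lemma eigval_perturb_entries:
  fixes A B :: "real mat"
  assumes A: "A \<in> carrier_mat n n" "transpose_mat A = A" and B: "B \<in> carrier_mat n n" "transpose_mat B = B"
    and i: "i < n"
    and d: "\<And>s t. s < n \<Longrightarrow> t < n \<Longrightarrow> \<bar>A $$ (s,t) - B $$ (s,t)\<bar> \<le> d"
  shows "\<bar>eigval (Suc i) A - eigval (Suc i) B\<bar> \<le> real n * d"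
proof -
  have "eigval (Suc i) A \<le> eigval (Suc i) B + real n * d"
    by (rule eigval_le_perturb[OF A B i], unfold quad_diff[symmetric], rule quad_le_entries) (rule d)
  moreover have "eigval (Suc i) B \<le> eigval (Suc i) A + real n * d"
    by (rule eigval_le_perturb[OF B A i], unfold quad_diff[symmetric], rule quad_le_entries)
       (use d in \<open>simp add: abs_minus_commute\<close>)
  ultimately show ?thesis by linarith
qed

section \<open>Measurability of eigenvalues\<close>

lemma borel_measurable_eigval:
  fixes A :: "'a \<Rightarrow> real mat"
  assumes A: "\<And>\<omega>. \<omega> \<in> space M \<Longrightarrow> A \<omega> \<in> carrier_mat n n"
    "\<And>\<omega>. \<omega> \<in> space M \<Longrightarrow> transpose_mat (A \<omega>) = A \<omega>"
    and meas: "\<And>s t. s \<le> t \<Longrightarrow> t < n \<Longrightarrow> (\<lambda>\<omega>. A \<omega> $$ (s, t)) \<in> borel_measurable M"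
    and i: "i < n"
  shows "(\<lambda>\<omega>. eigval (Suc i) (A \<omega>)) \<in> borel_measurable M"
proof -
  \<comment> \<open>Reading each entry at the ordered index pair makes \<open>B a\<close> symmetric
    for every array \<open>a\<close>, so the perturbation bound applies on the whole space of
    arrays.\<close>
  define B :: "(nat \<times> nat \<Rightarrow> real) \<Rightarrow> real mat" where
    "B a = Matrix.mat n n (\<lambda>(s, t). a (min s t, max s t))" for a
  have B: "B a \<in> carrier_mat n n" "transpose_mat (B a) = B a" for a
    unfolding B_def by (auto intro!: eq_matI simp: min.commute max.commute)
  \<comment> \<open>Arrays carry the product topology: convergence there controls the finitely many
    entries used, and a map into them is Borel as soon as each coordinate is.\<close>
  have "continuous_on UNIV (\<lambda>a. eigval (Suc i) (B a))"
    unfolding continuous_on_def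
  proof (intro ballI tendstoI)
    fix a :: "nat \<times> nat \<Rightarrow> real" and e :: real assume e: "e > 0"
    \<comment> \<open>Chosen so that the perturbation bound \<open>n * d\<close> equals
      \<open>e / 2\<close>.\<close>
    define d where "d = e / (2 * real n)"
    have d: "d > 0" unfolding d_def using e i by simp
    have "\<forall>p\<in>{..<n} \<times> {..<n}. \<forall>\<^sub>F b in at a. dist (b p) (a p) < d"
    proof
      fix p :: "nat \<times> nat"
      have "continuous_on UNIV (\<lambda>b :: nat \<times> nat \<Rightarrow> real. b p)"
        by (rule continuous_on_product_coordinates)
      hence "(\<lambda>b. b p) \<midarrow>a\<rightarrow> a p" by (simp add: continuous_on_def)
      thus "\<forall>\<^sub>F b in at a. dist (b p) (a p) < d" using d by (rule tendstoD)
    qed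
    hence "\<forall>\<^sub>F b in at a. \<forall>p\<in>{..<n} \<times> {..<n}. dist (b p) (a p) < d"
      by (intro eventually_ball_finite) auto
    thus "\<forall>\<^sub>F b in at a within UNIV. dist (eigval (Suc i) (B b)) (eigval (Suc i) (B a)) < e"
    proof (rule eventually_mono)
      fix b assume b: "\<forall>p\<in>{..<n} \<times> {..<n}. dist (b p) (a p) < d"
      have "\<bar>eigval (Suc i) (B b) - eigval (Suc i) (B a)\<bar> \<le> real n * d"
      proof (rule eigval_perturb_entries[OF B B i])
        fix s t assume st: "s < n" "t < n"
        hence mm: "(min s t, max s t) \<in> {..<n} \<times> {..<n}" by auto
        thus "\<bar>B b $$ (s,t) - B a $$ (s,t)\<bar> \<le> d"
          using bspec[OF b mm] st by (simp add: B_def dist_real_def)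
      qed
      also have "real n * d < e" unfolding d_def using i e by simp
      finally show "dist (eigval (Suc i) (B b)) (eigval (Suc i) (B a)) < e" by (simp add: dist_real_def)
    qed
  qed
  hence 1: "(\<lambda>a. eigval (Suc i) (B a)) \<in> borel_measurable borel"
    by (rule borel_measurable_continuous_onI)
  \<comment> \<open>Only the upper triangle is known to be measurable; all other coordinates are set
    to 0, and \<open>B\<close> does not look at them.\<close>
  define E where "E \<omega> = (\<lambda>(s, t). if s \<le> t \<and> t < n then A \<omega> $$ (s, t) else 0)" for \<omega>
  have "(\<lambda>\<omega>. E \<omega> p) \<in> borel_measurable M" for p
  proof (cases "fst p \<le> snd p \<and> snd p < n")
    case True
    thus ?thesis using meas[of "fst p" "snd p"] by (simp add: E_def case_prod_unfold)
  next
    case False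
    hence "(\<lambda>\<omega>. E \<omega> p) = (\<lambda>\<omega>. 0)" by (auto simp: E_def case_prod_unfold)
    thus ?thesis by simp
  qed
  hence 2: "E \<in> borel_measurable M" by (rule measurable_coordinatewise_then_product)
  have "B (E \<omega>) = A \<omega>" if "\<omega> \<in> space M" for \<omega>
  proof (rule eq_matI)
    fix s t assume "s < dim_row (A \<omega>)" "t < dim_col (A \<omega>)"
    hence st: "s < n" "t < n" using A(1)[OF that] by auto
    hence "A \<omega> $$ (s, t) = A \<omega> $$ (t, s)"
      using arg_cong[OF A(2)[OF that], of "\<lambda>C. C $$ (s,t)"] A(1)[OF that] by auto
    thus "B (E \<omega>) $$ (s, t) = A \<omega> $$ (s, t)"
      using st by (auto simp: B_def E_def min_def max_def)
  qed (use A(1)[OF that] in \<open>auto simp: B_def\<close>)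
  thus ?thesis using measurable_compose[OF 2 1] by (subst measurable_cong[where g = "\<lambda>\<omega>. eigval (Suc i) (B (E \<omega>))"]) auto
qed

section \<open>Trace moments and walks\<close>

text \<open>The \<open>(s, t)\<close> entry of the \<open>k\<close>-th matrix power, as a recursion
  that unfolds into walks.\<close>

primrec walk_pow :: "nat \<Rightarrow> (nat \<Rightarrow> nat \<Rightarrow> real) \<Rightarrow> nat \<Rightarrow> nat \<Rightarrow> nat \<Rightarrow> real" where
  "walk_pow n a 0 s t = (if s = t then 1 else 0)"
| "walk_pow n a (Suc k) s t = (\<Sum>l<n. a s l * walk_pow n a k l t)"

text \<open>The witness \<open>e\<close> lists the eigenvalues. Power sums and form bound share one
  existential because the trace has to control the very numbers that bound the form.\<close>

lemma symmetric_walk_trace: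
  fixes a :: "nat \<Rightarrow> nat \<Rightarrow> real"
  assumes sym: "\<And>s t. s < n \<Longrightarrow> t < n \<Longrightarrow> a s t = a t s"
  shows "\<exists>e. (\<forall>k. (\<Sum>s<n. walk_pow n a k s s) = (\<Sum>j<n. e j ^ k)) \<and>
    (\<forall>d x. (\<forall>j<n. \<bar>e j\<bar> \<le> d) \<longrightarrow> \<bar>quad n a x\<bar> \<le> d * dot n x x)"
proof -
  define A where "A = Matrix.mat n n (\<lambda>(s,t). a s t)"
  have A: "A \<in> carrier_mat n n" "transpose_mat A = A"
    unfolding A_def using sym by (auto intro!: eq_matI)
  define e where "e j = eigval (Suc j) A" for j
  obtain u where uf: "eigenframe n A u" using eigenframe_exists[OF A] .
  note u = eigenframe_Parseval[OF uf] eigenframe_quad[OF uf, folded e_def] eigenframe_orthonormal[OF uf]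
  have u4: "(\<Sum>j<n. u j s * u j t) = (if s = t then 1 else 0)"
    and u5: "a s t = (\<Sum>j<n. e j * u j s * u j t)" if "s < n" "t < n" for s t
    using uf that unfolding eigenframe_def e_def by (auto simp: A_def)
  have pow: "walk_pow n a k s t = (\<Sum>j<n. e j ^ k * u j s * u j t)" if "s < n" "t < n" for k s t
    using that(1)
  proof (induction k arbitrary: s)
    case 0
    thus ?case using that u4 by simp
  next
    case (Suc k)
    have "walk_pow n a (Suc k) s t = (\<Sum>l<n. (\<Sum>i<n. e i * u i s * u i l) * (\<Sum>j<n. e j ^ k * u j l * u j t))"
      using Suc u5 by simp
    also have "\<dots> = (\<Sum>l<n. \<Sum>i<n. \<Sum>j<n. e i * u i s * (e j ^ k * u j t) * (u i l * u j l))"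
      by (intro sum.cong refl, subst sum_product, intro sum.cong refl) (simp add: mult_ac)
    also have "\<dots> = (\<Sum>i<n. \<Sum>j<n. \<Sum>l<n. e i * u i s * (e j ^ k * u j t) * (u i l * u j l))"
      by (subst sum.swap, rule sum.cong[OF refl], rule sum.swap)
    also have "\<dots> = (\<Sum>i<n. \<Sum>j<n. e i * u i s * (e j ^ k * u j t) * dot n (u i) (u j))"
      unfolding dot_def by (simp add: sum_distrib_left)
    also have "\<dots> = (\<Sum>i<n. \<Sum>j<n. if j = i then e i * u i s * (e j ^ k * u j t) else 0)"
      by (intro sum.cong) (auto simp: u(3))
    also have "\<dots> = (\<Sum>j<n. e j ^ Suc k * u j s * u j t)"
      by (simp add: mult_ac)
    finally show ?case .
  qed
  have "(\<Sum>s<n. walk_pow n a k s s) = (\<Sum>j<n. e j ^ k)" for k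
  proof -
    have "(\<Sum>s<n. walk_pow n a k s s) = (\<Sum>s<n. \<Sum>j<n. e j ^ k * (u j s * u j s))"
      using pow by (simp add: mult.assoc)
    also have "\<dots> = (\<Sum>j<n. e j ^ k * dot n (u j) (u j))"
      unfolding dot_def sum_distrib_left by (rule sum.swap)
    finally show ?thesis using u(3) by simp
  qed
  moreover have "\<bar>quad n a x\<bar> \<le> d * dot n x x" if e: "\<forall>j<n. \<bar>e j\<bar> \<le> d" for d x
  proof -
    have "quad n a x = quad n (\<lambda>s t. A $$ (s,t)) x"
      by (rule quad_cong) (simp add: A_def)
    also have "\<bar>\<dots>\<bar> \<le> (\<Sum>j<n. \<bar>e j * (dot n (u j) x)\<^sup>2\<bar>)"
      unfolding u(2) by (rule sum_abs)
    also have "\<dots> \<le> (\<Sum>j<n. d * (dot n (u j) x)\<^sup>2)"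
      by (intro sum_mono) (use e in \<open>auto simp: abs_mult intro!: mult_right_mono\<close>)
    also have "\<dots> = d * dot n x x" unfolding u(1)[of x] sum_distrib_left ..
    finally show ?thesis .
  qed
  ultimately show ?thesis by (intro exI[of _ e] conjI allI impI)
qed

lemma trace_even_power_nonneg:
  assumes "\<And>s t. s < n \<Longrightarrow> t < n \<Longrightarrow> a s t = a t s"
  shows "0 \<le> (\<Sum>s<n. walk_pow n a (2 * m) s s)"
proof -
  have "\<exists>e. (\<forall>k. (\<Sum>s<n. walk_pow n a k s s) = (\<Sum>j<n. e j ^ k)) \<and>
    (\<forall>d x. (\<forall>j<n. \<bar>e j\<bar> \<le> d) \<longrightarrow> \<bar>quad n a x\<bar> \<le> d * dot n x x)"
    by (rule symmetric_walk_trace[OF assms])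
  then obtain e where "\<forall>k. (\<Sum>s<n. walk_pow n a k s s) = (\<Sum>j<n. e j ^ k)"
    by (elim exE conjE)
  thus ?thesis by (simp add: sum_nonneg)
qed

lemma quad_le_trace:
  fixes a :: "nat \<Rightarrow> nat \<Rightarrow> real"
  assumes sym: "\<And>s t. s < n \<Longrightarrow> t < n \<Longrightarrow> a s t = a t s" and d: "d \<ge> 0" and m: "m > 0"
    and tr: "(\<Sum>s<n. walk_pow n a (2 * m) s s) \<le> d ^ (2 * m)"
  shows "\<bar>quad n a x\<bar> \<le> d * dot n x x"
proof -
  have "\<exists>e. (\<forall>k. (\<Sum>s<n. walk_pow n a k s s) = (\<Sum>j<n. e j ^ k)) \<and>
    (\<forall>d x. (\<forall>j<n. \<bar>e j\<bar> \<le> d) \<longrightarrow> \<bar>quad n a x\<bar> \<le> d * dot n x x)"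
    by (rule symmetric_walk_trace[OF sym])
  then obtain e where e: "\<forall>k. (\<Sum>s<n. walk_pow n a k s s) = (\<Sum>j<n. e j ^ k)"
    "\<forall>d x. (\<forall>j<n. \<bar>e j\<bar> \<le> d) \<longrightarrow> \<bar>quad n a x\<bar> \<le> d * dot n x x"
    by (elim exE conjE)
  show ?thesis
  proof (rule e(2)[rule_format])
    fix j assume j: "j < n"
    \<comment> \<open>Evenness of the exponent makes all other summands nonnegative and removes the
      sign of \<open>e j\<close>.\<close>
    have "e j ^ (2 * m) \<le> (\<Sum>j<n. e j ^ (2 * m))"
      by (rule member_le_sum) (use j in auto)
    hence "\<bar>e j\<bar> ^ (2 * m) \<le> d ^ (2 * m)" using tr e(1) by (simp add: power_even_abs)
    thus "\<bar>e j\<bar> \<le> d" using d m by (metis power_mono_iff abs_ge_zero nat_0_less_mult_iff zero_less_numeral)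
  qed
qed

section \<open>Walks and their edges\<close>

fun walk_weight :: "(nat \<Rightarrow> nat \<Rightarrow> real) \<Rightarrow> nat \<Rightarrow> nat list \<Rightarrow> real" where
  "walk_weight a s [] = 1"
| "walk_weight a s (v # vs) = a s v * walk_weight a v vs"

text \<open>Edges are undirected, stored as ordered pairs so that they index exactly the independent
  upper triangular entries; repetitions are kept, since multiplicities become exponents.\<close>

fun walk_edges :: "nat \<Rightarrow> nat list \<Rightarrow> (nat \<times> nat) list" where
  "walk_edges s [] = []"
| "walk_edges s (v # vs) = (min s v, max s v) # walk_edges v vs"

definition vertex_lists :: "nat \<Rightarrow> nat \<Rightarrow> nat list set" where
  "vertex_lists n k = {vs. set vs \<subseteq> {..<n} \<and> length vs = k}"

lemma finite_vertex_lists [simp]: "finite (vertex_lists n k)"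
  unfolding vertex_lists_def by (simp add: finite_lists_length_eq)

lemma sum_vertex_lists_Suc:
  fixes f :: "nat list \<Rightarrow> 'b :: comm_monoid_add"
  shows "(\<Sum>vs\<in>vertex_lists n (Suc k). f vs) = (\<Sum>v<n. \<Sum>vs\<in>vertex_lists n k. f (v # vs))"
proof -
  have "(\<Sum>v<n. \<Sum>vs\<in>vertex_lists n k. f (v # vs)) = (\<Sum>(v, vs)\<in>{..<n} \<times> vertex_lists n k. f (v # vs))"
    by (simp add: sum.cartesian_product)
  also have "\<dots> = (\<Sum>vs\<in>vertex_lists n (Suc k). f vs)"
    by (rule sum.reindex_bij_witness[where j = "\<lambda>(v, vs). v # vs" and i = "\<lambda>vs. (hd vs, tl vs)"])
       (auto simp: vertex_lists_def length_Suc_conv)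
  finally show ?thesis ..
qed

lemma walk_pow_eq_sum_walks:
  "walk_pow n a k s t = (\<Sum>vs\<in>vertex_lists n k. if last (s # vs) = t then walk_weight a s vs else 0)"
proof (induction k arbitrary: s)
  case 0
  have "vertex_lists n 0 = {[]}" unfolding vertex_lists_def by auto
  thus ?case by simp
next
  case (Suc k)
  have "a s l * walk_pow n a k l t = (\<Sum>vs\<in>vertex_lists n k. if last (l # vs) = t then a s l * walk_weight a l vs else 0)" for l
    unfolding Suc.IH sum_distrib_left by (intro sum.cong) auto
  thus ?case unfolding sum_vertex_lists_Suc by (simp cong: if_cong)
qed

text \<open>Collecting equal edges turns a walk into a product of powers of independent entries. The
  product runs over a fixed superset \<open>E\<close>, where edges not on the walk have exponent 0,
  so that independence can be applied over the whole triangle.\<close>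

lemma walk_weight_eq_prod_edges:
  assumes sym: "\<And>s t. s < n \<Longrightarrow> t < n \<Longrightarrow> a s t = a t s"
    and fin: "finite E" and E: "set (walk_edges s vs) \<subseteq> E" and s: "s < n" and vs: "set vs \<subseteq> {..<n}"
  shows "walk_weight a s vs = (\<Prod>e\<in>E. a (fst e) (snd e) ^ count_list (walk_edges s vs) e)"
  using E s vs
proof (induction vs arbitrary: s)
  case (Cons v vs)
  let ?e = "(min s v, max s v)"
  have "a s v = a (min s v) (max s v)"
    using sym[of s v] Cons.prems by (simp add: min_def max_def)
  moreover have "walk_weight a v vs = (\<Prod>e\<in>E. a (fst e) (snd e) ^ count_list (walk_edges v vs) e)"
    using Cons by auto
  ultimately have "walk_weight a s (v # vs) = a (min s v) (max s v) *
      (\<Prod>e\<in>E. a (fst e) (snd e) ^ count_list (walk_edges v vs) e)" by simp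
  also have "a (min s v) (max s v) = (\<Prod>e\<in>E. a (fst e) (snd e) ^ (if e = ?e then 1 else 0))"
  proof -
    have "?e \<in> E" using Cons.prems by simp
    hence "(\<Prod>e\<in>E. if e = ?e then a (fst e) (snd e) else 1) = a (min s v) (max s v)"
      using fin by (simp add: prod.delta)
    moreover have "(\<Prod>e\<in>E. a (fst e) (snd e) ^ (if e = ?e then 1 else 0)) = (\<Prod>e\<in>E. if e = ?e then a (fst e) (snd e) else 1)"
      by (intro prod.cong) auto
    ultimately show ?thesis by simp
  qed
  also have "\<dots> * (\<Prod>e\<in>E. a (fst e) (snd e) ^ count_list (walk_edges v vs) e)
      = (\<Prod>e\<in>E. a (fst e) (snd e) ^ count_list (walk_edges s (v # vs)) e)"
    unfolding prod.distrib[symmetric] by (intro prod.cong) auto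
  finally show ?case .
qed simp

section \<open>Counting walks by their vertices\<close>

lemma length_walk_edges: "length (walk_edges s vs) = length vs"
  by (induction vs arbitrary: s) auto

lemma walk_edges_subset:
  assumes "s < n" "set vs \<subseteq> {..<n}"
  shows "set (walk_edges s vs) \<subseteq> {(i, j). i \<le> j \<and> j < n}"
  using assms by (induction vs arbitrary: s) auto

text \<open>A walk visits a new vertex only along a new edge.\<close>

lemma card_walk_vertices_le:
  "card (set (s # vs)) \<le> Suc (card (set (walk_edges s vs)))"
proof (induction vs arbitrary: s)
  case (Cons v vs)
  have IH: "card (insert v (set vs)) \<le> Suc (card (set (walk_edges v vs)))" using Cons by simp
  show ?case
  proof (cases "s \<in> insert v (set vs)")
    case True
    hence "set (s # v # vs) = insert v (set vs)" by auto
    moreover have "card (set (walk_edges v vs)) \<le> card (set (walk_edges s (v # vs)))"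
      by (intro card_mono) auto
    ultimately show ?thesis using IH by simp
  next
    case False
    \<comment> \<open>Induction peels off the start, so newness is judged against the rest of the
      walk. Edges of the rest join its own vertices; if \<open>s\<close> never recurs, the first
      edge, which has \<open>s\<close> as an end, cannot recur either.\<close>
    have incl: "set (walk_edges w us) \<subseteq> {(i, j). i \<in> insert w (set us) \<and> j \<in> insert w (set us)}" for w us
    proof (induction us arbitrary: w)
      case (Cons u us)
      have "(min w u, max w u) \<in> {(i, j). i \<in> insert w (set (u # us)) \<and> j \<in> insert w (set (u # us))}"
        by (auto simp: min_def max_def)
      thus ?case using Cons[of u] by auto
    qed simp
    have "(min s v, max s v) \<notin> set (walk_edges v vs)"
      using incl[of v vs] False by (auto simp: min_def max_def split: if_splits)
    thus ?thesis using IH False by simp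
  qed
qed simp

lemma count_list_ge2_card_le:
  assumes "\<And>x. x \<in> set xs \<Longrightarrow> count_list xs x \<ge> 2"
  shows "2 * card (set xs) \<le> length xs"
proof -
  have "(\<Sum>x\<in>set xs. 2) \<le> (\<Sum>x\<in>set xs. count_list xs x)" by (intro sum_mono assms)
  thus ?thesis by (simp add: sum_count_set)
qed

text \<open>First choose the support, then fill \<open>K\<close> places from it. Each support of
  size \<open>v\<close> is the set of some list of length \<open>v\<close>, whence at most
  \<open>n ^ v\<close> choices.\<close>

lemma card_vertex_lists_support_le:
  assumes "v > 0"
  shows "card {xs \<in> vertex_lists n K. card (set xs) = v} \<le> n ^ v * v ^ K"
proof -
  define VV where "VV = {V. V \<subseteq> {..<n} \<and> card V = v}"
  have finVV: "finite VV" unfolding VV_def by simp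
  have "VV \<subseteq> set ` vertex_lists n v"
  proof
    fix V assume "V \<in> VV"
    hence V: "V \<subseteq> {..<n}" "card V = v" "finite V" unfolding VV_def using finite_subset by auto
    then obtain xs where "set xs = V" "length xs = v" using finite_distinct_list distinct_card by metis
    thus "V \<in> set ` vertex_lists n v" using V unfolding vertex_lists_def by auto
  qed
  hence "card VV \<le> card (set ` vertex_lists n v)" by (intro card_mono) auto
  also have "\<dots> \<le> card (vertex_lists n v)" by (intro card_image_le) simp
  also have "\<dots> = n ^ v" unfolding vertex_lists_def by (simp add: card_lists_length_eq)
  finally have cVV: "card VV \<le> n ^ v" .
  have "{xs \<in> vertex_lists n K. card (set xs) = v} \<subseteq> (\<Union>V\<in>VV. {xs. set xs \<subseteq> V \<and> length xs = K})"
    unfolding VV_def vertex_lists_def by auto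
  moreover have fin: "finite {xs. set xs \<subseteq> V \<and> length xs = K}" "card {xs. set xs \<subseteq> V \<and> length xs = K} = v ^ K"
    if "V \<in> VV" for V
    using that unfolding VV_def by (auto simp: card_lists_length_eq finite_lists_length_eq finite_subset)
  ultimately have "card {xs \<in> vertex_lists n K. card (set xs) = v} \<le> card (\<Union>V\<in>VV. {xs. set xs \<subseteq> V \<and> length xs = K})"
    using finVV by (intro card_mono) auto
  also have "\<dots> \<le> (\<Sum>V\<in>VV. card {xs. set xs \<subseteq> V \<and> length xs = K})"
    by (rule card_UN_le[OF finVV])
  also have "\<dots> = card VV * v ^ K" using fin by simp
  also have "\<dots> \<le> n ^ v * v ^ K" using cVV by simp
  finally show ?thesis .
qed

text \<open>Lists with \<open>v\<close> vertices contribute at most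
  \<open>n * v^K * (n q)^(v-1)\<close>; one factor \<open>n\<close> is left over because
  \<open>q\<close> occurs only \<open>v - 1\<close> times. As \<open>n q \<ge> 1\<close>, the
  largest \<open>v\<close> dominates, and the \<open>m + 1\<close> possible values of
  \<open>v\<close> account for the exponent \<open>Suc K\<close>.\<close>

lemma sum_walks_bound:
  fixes q :: real
  assumes q: "0 \<le> q" and nq: "1 \<le> real n * q"
  shows "(\<Sum>xs | xs \<in> vertex_lists n K \<and> 0 < card (set xs) \<and> card (set xs) \<le> Suc m. q ^ (card (set xs) - 1))
     \<le> real n * real (Suc m) ^ Suc K * (real n * q) ^ m"
proof -
  have "(\<Sum>xs | xs \<in> vertex_lists n K \<and> 0 < card (set xs) \<and> card (set xs) \<le> Suc m. q ^ (card (set xs) - 1))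
    = (\<Sum>v\<in>{1..Suc m}. \<Sum>xs | xs \<in> {xs. xs \<in> vertex_lists n K \<and> 0 < card (set xs) \<and> card (set xs) \<le> Suc m} \<and> card (set xs) = v. q ^ (card (set xs) - 1))"
    by (rule sum.group[symmetric]) auto
  also have "\<dots> \<le> (\<Sum>v\<in>{1..Suc m}. real n * real (Suc m) ^ K * (real n * q) ^ m)"
  proof (rule sum_mono)
    fix v assume v: "v \<in> {1..Suc m}"
    let ?X = "{xs \<in> vertex_lists n K. card (set xs) = v}"
    have "(\<Sum>xs | xs \<in> {xs. xs \<in> vertex_lists n K \<and> 0 < card (set xs) \<and> card (set xs) \<le> Suc m} \<and> card (set xs) = v. q ^ (card (set xs) - 1))
       = (\<Sum>xs\<in>?X. q ^ (v - 1))"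
      using v by (intro sum.cong) auto
    also have "\<dots> = real (card ?X) * q ^ (v - 1)" by simp
    also have "\<dots> \<le> real (n ^ v * v ^ K) * q ^ (v - 1)"
      using v q by (intro mult_right_mono of_nat_mono card_vertex_lists_support_le zero_le_power) auto
    also have "\<dots> = real n * real v ^ K * (real n * q) ^ (v - 1)"
      using v by (cases v) (auto simp: power_mult_distrib)
    also have "\<dots> \<le> real n * real (Suc m) ^ K * (real n * q) ^ m"
    proof (intro mult_mono)
      show "real v ^ K \<le> real (Suc m) ^ K" using v by (intro power_mono) auto
      show "(real n * q) ^ (v - 1) \<le> (real n * q) ^ m" using v by (intro power_increasing nq) auto
    qed (use q in auto)
    finally show "(\<Sum>xs | xs \<in> {xs. xs \<in> vertex_lists n K \<and> 0 < card (set xs) \<and> card (set xs) \<le> Suc m} \<and> card (set xs) = v. q ^ (card (set xs) - 1))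
       \<le> real n * real (Suc m) ^ K * (real n * q) ^ m" .
  qed
  also have "\<dots> = real n * real (Suc m) ^ Suc K * (real n * q) ^ m" by simp
  finally show ?thesis .
qed

text \<open>Independence gives one factor per distinct edge: zero for an edge met once, at most
  \<open>q\<close> otherwise. Because \<open>q \<le> 1\<close>, the exponent may be lowered from the
  number of edges to the number of vertices minus one, after which walks need only be sorted by
  their vertex sets.\<close>

lemma (in prob_space) expectation_walk_weight_le:
  fixes w :: "nat \<Rightarrow> nat \<Rightarrow> 'a \<Rightarrow> real"
  assumes sym: "\<And>s t \<omega>. s < n \<Longrightarrow> t < n \<Longrightarrow> \<omega> \<in> space M \<Longrightarrow> w s t \<omega> = w t s \<omega>"
    and indep: "indep_vars (\<lambda>_. borel) (\<lambda>(s, t). w s t) {(s, t). s \<le> t \<and> t < n}"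
    and int: "\<And>s t k. s \<le> t \<Longrightarrow> t < n \<Longrightarrow> integrable M (\<lambda>\<omega>. w s t \<omega> ^ k)"
    and mean: "\<And>s t. s \<le> t \<Longrightarrow> t < n \<Longrightarrow> expectation (w s t) = 0"
    and var: "\<And>s t k. s \<le> t \<Longrightarrow> t < n \<Longrightarrow> k \<ge> 2 \<Longrightarrow> \<bar>expectation (\<lambda>\<omega>. w s t \<omega> ^ k)\<bar> \<le> q"
    and q: "0 \<le> q" "q \<le> 1"
    and s: "s < n" and vs: "vs \<in> vertex_lists n (2 * m)"
  shows "integrable M (\<lambda>\<omega>. walk_weight (\<lambda>s t. w s t \<omega>) s vs)"
    and "\<bar>expectation (\<lambda>\<omega>. walk_weight (\<lambda>s t. w s t \<omega>) s vs)\<bar>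
       \<le> (if card (set (s # vs)) \<le> Suc m then q ^ (card (set (s # vs)) - 1) else 0)"
proof -
  define E where "E = {(s :: nat, t). s \<le> t \<and> t < n}"
  have finE: "finite E"
    by (rule finite_subset[of _ "{..<n} \<times> {..<n}"]) (auto simp: E_def)
  define c where "c = count_list (walk_edges s vs)"
  have vs': "set vs \<subseteq> {..<n}" "length vs = 2 * m" using vs unfolding vertex_lists_def by auto
  have sub: "set (walk_edges s vs) \<subseteq> E"
    unfolding E_def by (rule walk_edges_subset[OF s vs'(1)])
  define X where "X e \<omega> = w (fst e) (snd e) \<omega> ^ c e" for e \<omega>
  have eq: "walk_weight (\<lambda>s t. w s t \<omega>) s vs = (\<Prod>e\<in>E. X e \<omega>)" if "\<omega> \<in> space M" for \<omega>
    unfolding X_def c_def by (rule walk_weight_eq_prod_edges[OF _ finE sub s vs'(1)]) (rule sym[OF _ _ that])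
  have "indep_vars (\<lambda>_. borel) (\<lambda>e \<omega>. (case e of (s, t) \<Rightarrow> w s t) \<omega> ^ c e) E"
    by (rule indep_vars_compose2[OF indep[folded E_def]]) simp
  hence ind: "indep_vars (\<lambda>_. borel) X E"
    by (rule indep_vars_cong[THEN iffD1, rotated -1]) (auto simp: X_def fun_eq_iff)
  have intX: "integrable M (X e)" if "e \<in> E" for e
    using that unfolding X_def[abs_def] E_def by (auto intro: int)
  have "integrable M (\<lambda>\<omega>. \<Prod>e\<in>E. X e \<omega>)"
    by (rule indep_vars_integrable[OF finE ind intX])
  thus "integrable M (\<lambda>\<omega>. walk_weight (\<lambda>s t. w s t \<omega>) s vs)"
    by (subst Bochner_Integration.integrable_cong[OF refl eq]) auto
  have "expectation (\<lambda>\<omega>. walk_weight (\<lambda>s t. w s t \<omega>) s vs) = expectation (\<lambda>\<omega>. \<Prod>e\<in>E. X e \<omega>)"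
    by (rule Bochner_Integration.integral_cong[OF refl eq])
  also have "\<dots> = (\<Prod>e\<in>E. expectation (X e))"
    by (rule indep_vars_lebesgue_integral[OF finE ind intX])
  finally have Eprod: "expectation (\<lambda>\<omega>. walk_weight (\<lambda>s t. w s t \<omega>) s vs) = (\<Prod>e\<in>E. expectation (X e))" .
  show "\<bar>expectation (\<lambda>\<omega>. walk_weight (\<lambda>s t. w s t \<omega>) s vs)\<bar>
       \<le> (if card (set (s # vs)) \<le> Suc m then q ^ (card (set (s # vs)) - 1) else 0)"
  proof (cases "\<exists>e\<in>E. c e = 1")
    case True
    then obtain e where e: "e \<in> E" "c e = 1" by blast
    have "expectation (X e) = 0"
      using mean[of "fst e" "snd e"] e unfolding X_def[abs_def] E_def by auto
    hence "(\<Prod>e\<in>E. expectation (X e)) = 0" using finE e(1) by (metis prod_zero_iff)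
    thus ?thesis unfolding Eprod using q by simp
  next
    case False
    have c2: "c e \<ge> 2" if "e \<in> set (walk_edges s vs)" for e
    proof -
      have "c e \<noteq> 0" using that unfolding c_def by (simp add: count_list_0_iff)
      moreover have "c e \<noteq> 1" using that sub False by blast
      ultimately show ?thesis by linarith
    qed
    have "2 * card (set (walk_edges s vs)) \<le> 2 * m"
      using count_list_ge2_card_le[of "walk_edges s vs"] c2 vs'(2) unfolding c_def length_walk_edges by simp
    hence cm: "card (set (walk_edges s vs)) \<le> m" by simp
    have "\<bar>\<Prod>e\<in>E. expectation (X e)\<bar> = (\<Prod>e\<in>E. \<bar>expectation (X e)\<bar>)" by (rule abs_prod)
    also have "\<dots> \<le> (\<Prod>e\<in>E. if e \<in> set (walk_edges s vs) then q else 1)"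
    proof (rule prod_mono, intro conjI)
      fix e assume e: "e \<in> E"
      show "\<bar>expectation (X e)\<bar> \<le> (if e \<in> set (walk_edges s vs) then q else 1)"
      proof (cases "e \<in> set (walk_edges s vs)")
        case True
        thus ?thesis using var[of "fst e" "snd e" "c e"] c2[of e] e unfolding X_def[abs_def] E_def by auto
      next
        case False
        hence "c e = 0" unfolding c_def by (simp add: count_list_0_iff)
        thus ?thesis using False by (simp add: X_def[abs_def] prob_space)
      qed
    qed simp
    also have "\<dots> = q ^ card (set (walk_edges s vs))"
      using finE sub by (simp add: prod.If_cases Int_absorb1)
    also have "\<dots> \<le> q ^ (card (set (s # vs)) - 1)"
      using card_walk_vertices_le[of s vs] q by (intro power_decreasing) linarith+
    finally have "\<bar>\<Prod>e\<in>E. expectation (X e)\<bar> \<le> q ^ (card (set (s # vs)) - 1)" .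
    moreover have "card (set (s # vs)) \<le> Suc m" using card_walk_vertices_le[of s vs] cm by linarith
    ultimately show ?thesis unfolding Eprod by simp
  qed
qed

lemma (in prob_space) expectation_trace_le:
  fixes w :: "nat \<Rightarrow> nat \<Rightarrow> 'a \<Rightarrow> real"
  assumes sym: "\<And>s t \<omega>. s < n \<Longrightarrow> t < n \<Longrightarrow> \<omega> \<in> space M \<Longrightarrow> w s t \<omega> = w t s \<omega>"
    and indep: "indep_vars (\<lambda>_. borel) (\<lambda>(s, t). w s t) {(s, t). s \<le> t \<and> t < n}"
    and int: "\<And>s t k. s \<le> t \<Longrightarrow> t < n \<Longrightarrow> integrable M (\<lambda>\<omega>. w s t \<omega> ^ k)"
    and mean: "\<And>s t. s \<le> t \<Longrightarrow> t < n \<Longrightarrow> expectation (w s t) = 0"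
    and var: "\<And>s t k. s \<le> t \<Longrightarrow> t < n \<Longrightarrow> k \<ge> 2 \<Longrightarrow> \<bar>expectation (\<lambda>\<omega>. w s t \<omega> ^ k)\<bar> \<le> q"
    and q: "0 \<le> q" "q \<le> 1" and nq: "1 \<le> real n * q"
  shows "integrable M (\<lambda>\<omega>. \<Sum>s<n. walk_pow n (\<lambda>s t. w s t \<omega>) (2 * m) s s)"
    and "expectation (\<lambda>\<omega>. \<Sum>s<n. walk_pow n (\<lambda>s t. w s t \<omega>) (2 * m) s s)
       \<le> real n * real (Suc m) ^ (2 * m + 2) * (real n * q) ^ m"
proof -
  have ww1: "integrable M (\<lambda>\<omega>. walk_weight (\<lambda>s t. w s t \<omega>) s vs)"
    if "s < n" "vs \<in> vertex_lists n (2 * m)" for s vs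
    by (rule expectation_walk_weight_le(1)[OF sym indep int mean var q that])
  have ww2: "\<bar>expectation (\<lambda>\<omega>. walk_weight (\<lambda>s t. w s t \<omega>) s vs)\<bar>
       \<le> (if card (set (s # vs)) \<le> Suc m then q ^ (card (set (s # vs)) - 1) else 0)"
    if "s < n" "vs \<in> vertex_lists n (2 * m)" for s vs
    by (rule expectation_walk_weight_le(2)[OF sym indep int mean var q that])
  have int': "integrable M (\<lambda>\<omega>. if last (s # vs) = s then walk_weight (\<lambda>s t. w s t \<omega>) s vs else 0)"
    if "s < n" "vs \<in> vertex_lists n (2 * m)" for s vs
    using ww1[OF that] by (cases "last (s # vs) = s") auto
  show "integrable M (\<lambda>\<omega>. \<Sum>s<n. walk_pow n (\<lambda>s t. w s t \<omega>) (2 * m) s s)"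
    unfolding walk_pow_eq_sum_walks by (intro Bochner_Integration.integrable_sum int') auto
  let ?b = "\<lambda>xs. if card (set xs) \<le> Suc m then q ^ (card (set xs) - 1) else 0"
  have "expectation (\<lambda>\<omega>. \<Sum>s<n. walk_pow n (\<lambda>s t. w s t \<omega>) (2 * m) s s)
    = (\<Sum>s<n. \<Sum>vs\<in>vertex_lists n (2 * m).
         expectation (\<lambda>\<omega>. if last (s # vs) = s then walk_weight (\<lambda>s t. w s t \<omega>) s vs else 0))"
    unfolding walk_pow_eq_sum_walks
    by (simp add: Bochner_Integration.integral_sum Bochner_Integration.integrable_sum int' del: last.simps)
  also have "\<dots> \<le> (\<Sum>s<n. \<Sum>vs\<in>vertex_lists n (2 * m). ?b (s # vs))"
  proof (intro sum_mono)
    fix s vs assume *: "s \<in> {..<n}" "vs \<in> vertex_lists n (2 * m)"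
    hence "s < n" by simp
    \<comment> \<open>Lists that do not return to \<open>s\<close> contribute 0 and still satisfy
      the nonnegative bound. Forgetting closedness leaves a count over all lists of
      \<open>2 * m + 1\<close> vertices.\<close>
    have "0 \<le> ?b (s # vs)" using q by simp
    thus "expectation (\<lambda>\<omega>. if last (s # vs) = s then walk_weight (\<lambda>s t. w s t \<omega>) s vs else 0) \<le> ?b (s # vs)"
      using ww2[OF \<open>s < n\<close> *(2)] by (cases "last (s # vs) = s") (auto simp del: set_simps)
  qed
  also have "\<dots> = (\<Sum>xs\<in>vertex_lists n (Suc (2 * m)). ?b xs)"
    by (rule sum_vertex_lists_Suc[symmetric])
  also have "\<dots> = (\<Sum>xs | xs \<in> vertex_lists n (Suc (2 * m)) \<and> 0 < card (set xs) \<and> card (set xs) \<le> Suc m. q ^ (card (set xs) - 1))"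
  proof -
    have "0 < card (set xs)" if "xs \<in> vertex_lists n (Suc (2 * m))" for xs
      using that by (auto simp: vertex_lists_def card_gt_0_iff)
    hence "{xs \<in> vertex_lists n (Suc (2 * m)). 0 < card (set xs) \<and> card (set xs) \<le> Suc m}
        = {xs \<in> vertex_lists n (Suc (2 * m)). card (set xs) \<le> Suc m}" by blast
    thus ?thesis by (simp only: sum.inter_filter[OF finite_vertex_lists])
  qed
  also have "\<dots> \<le> real n * real (Suc m) ^ Suc (Suc (2 * m)) * (real n * q) ^ m"
    by (rule sum_walks_bound[OF q(1) nq])
  finally show "expectation (\<lambda>\<omega>. \<Sum>s<n. walk_pow n (\<lambda>s t. w s t \<omega>) (2 * m) s s)
       \<le> real n * real (Suc m) ^ (2 * m + 2) * (real n * q) ^ m" by simp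
qed

section \<open>Riemann sums of orthonormal functions\<close>

lemma equipartition_tagged_division:
  assumes N: "N > 0" and z: "\<And>i. i < N \<Longrightarrow> z i \<in> {real i / real N..real (Suc i) / real N}"
  shows "(\<lambda>i. (z i, {real i / real N..real (Suc i) / real N})) ` {..<N} tagged_division_of {0..1}"
    (is "?p tagged_division_of _")
proof (rule tagged_division_ofI)
  show "finite ?p" by simp
next
  fix x K assume "(x, K) \<in> ?p"
  then obtain i where i: "i < N" "x = z i" "K = {real i / real N..real (Suc i) / real N}" by auto
  show "x \<in> K" using z i by auto
  have "real (Suc i) / real N \<le> 1" using i(1) N by (simp add: field_simps)
  moreover have "0 \<le> real i / real N" by simp
  ultimately show "K \<subseteq> {0..1}" unfolding i(3) by (simp only: atLeastatMost_subset_iff) auto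
  show "\<exists>a b. K = cbox a b" unfolding i(3) by (metis interval_cbox)
next
  fix x1 K1 x2 K2 assume *: "(x1, K1) \<in> ?p" "(x2, K2) \<in> ?p" "(x1, K1) \<noteq> (x2, K2)"
  then obtain i j where i: "i < N" "x1 = z i" "K1 = {real i / real N..real (Suc i) / real N}"
    and j: "j < N" "x2 = z j" "K2 = {real j / real N..real (Suc j) / real N}" by auto
  have "real (Suc i) \<le> real j \<or> real (Suc j) \<le> real i" using i j *(3) by (cases i j rule: linorder_cases) auto
  hence "real (Suc i) / real N \<le> real j / real N \<or> real (Suc j) / real N \<le> real i / real N"
    using N divide_right_mono[of _ _ "real N"] by (metis of_nat_0_le_iff)
  thus "interior K1 \<inter> interior K2 = {}" unfolding i(3) j(3) interior_atLeastAtMost_real by fastforce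
next
  show "\<Union> {K. \<exists>x. (x, K) \<in> ?p} = {0..1}"
  proof (intro equalityI subsetI)
    fix x assume "x \<in> \<Union> {K. \<exists>x. (x, K) \<in> ?p}"
    then obtain i where i: "i < N" and x: "x \<in> {real i / real N..real (Suc i) / real N}" by auto
    have "real (Suc i) / real N \<le> 1" using i N by (simp add: field_simps)
    moreover have "0 \<le> real i / real N" by simp
    ultimately show "x \<in> {0..1}" using x unfolding atLeastAtMost_iff by linarith
  next
    fix x :: real assume x: "x \<in> {0..1}"
    have "\<exists>i<N. x \<in> {real i / real N..real (Suc i) / real N}"
    \<comment> \<open>At the right end the floor would give the cell index \<open>N\<close>, which
      is out of range.\<close>
    proof (cases "x = 1")
      case True
      thus ?thesis using N by (intro exI[of _ "N - 1"]) (auto simp: field_simps)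
    next
      case False
      define i where "i = nat \<lfloor>real N * x\<rfloor>"
      have "0 \<le> \<lfloor>real N * x\<rfloor>" using x by simp
      hence i: "real i \<le> real N * x" "real N * x < real i + 1" unfolding i_def by linarith+
      have "real N * x < real N" using x False N by simp
      hence "i < N" using i(1) by linarith
      thus ?thesis using i N by (intro exI[of _ i]) (auto simp: field_simps)
    qed
    thus "x \<in> \<Union> {K. \<exists>x. (x, K) \<in> ?p}" by blast
  qed
qed

lemma equipartition_sum:
  assumes N: "N > 0"
  shows "(\<Sum>(x, K)\<in>(\<lambda>i. (z i, {real i / real N..real (Suc i) / real N})) ` {..<N}. measure lborel K * g x)
     = (\<Sum>i<N. g (z i)) / real N"
proof -
  \<comment> \<open>The division is a set of pairs, so no summand may be merged: neighbouring tags
    can coincide, but the cells differ.\<close>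
  have "inj_on (\<lambda>i. (z i, {real i / real N..real (Suc i) / real N})) {..<N}"
  proof (rule inj_onI)
    fix i j
    assume "(z i, {real i / real N..real (Suc i) / real N}) = (z j, {real j / real N..real (Suc j) / real N})"
    hence "real i / real N = real j / real N"
      using N by (simp add: Icc_eq_Icc divide_right_mono)
    thus "i = j" using N by simp
  qed
  hence "(\<Sum>(x, K)\<in>(\<lambda>i. (z i, {real i / real N..real (Suc i) / real N})) ` {..<N}. measure lborel K * g x)
      = (\<Sum>i<N. measure lborel {real i / real N..real (Suc i) / real N} * g (z i))"
    by (subst sum.reindex) auto
  also have "\<dots> = (\<Sum>i<N. g (z i) / real N)"
  proof (rule sum.cong[OF refl])
    fix i
    have "measure lborel {real i / real N..real (Suc i) / real N} = 1 / real N"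
      by (subst measure_lborel_Icc) (auto simp: divide_right_mono diff_divide_distrib[symmetric])
    thus "measure lborel {real i / real N..real (Suc i) / real N} * g (z i) = g (z i) / real N"
      by simp
  qed
  finally show ?thesis by (simp add: sum_divide_distrib)
qed

text \<open>In every cell let one family of tags take the larger value and another the smaller. Both
  Riemann sums are within \<open>e / 2\<close> of the integral, and their difference is the sum of
  absolute differences. The threshold \<open>N0\<close> is fixed before the tags.\<close>

lemma riemann_integrable_oscillation:
  assumes g: "riemann_integrable 0 1 g" and e: "e > 0"
  obtains N0 where "\<And>N x y. \<lbrakk>N \<ge> N0; N > 0;
      \<And>i. i < N \<Longrightarrow> x i \<in> {real i / real N..real (Suc i) / real N};
      \<And>i. i < N \<Longrightarrow> y i \<in> {real i / real N..real (Suc i) / real N}\<rbrakk> \<Longrightarrow>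
      (\<Sum>i<N. \<bar>g (x i) - g (y i)\<bar>) \<le> e * real N"
proof -
  obtain I where I: "\<forall>e>0. \<exists>d>0. \<forall>p. p tagged_division_of {0..1} \<and> (\<forall>(x, K)\<in>p. measure lborel K < d) \<longrightarrow>
        \<bar>(\<Sum>(x, K)\<in>p. measure lborel K * g x) - I\<bar> < e"
    using g unfolding riemann_integrable_def by (rule exE)
  have "e / 2 > 0" using e by simp
  from mp[OF spec[OF I] this] obtain d where d: "d > 0" and
    dI: "\<forall>p. p tagged_division_of {0..1} \<and> (\<forall>(x, K)\<in>p. measure lborel K < d) \<longrightarrow>
        \<bar>(\<Sum>(x, K)\<in>p. measure lborel K * g x) - I\<bar> < e / 2"
    by (elim exE conjE)
  obtain N0 :: nat where N0: "1 / d < real N0" using reals_Archimedean2 by blast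
  show thesis
  proof (rule that[of N0])
    fix N :: nat and x y :: "nat \<Rightarrow> real"
    assume N: "N \<ge> N0" "N > 0"
      and x: "\<And>i. i < N \<Longrightarrow> x i \<in> {real i / real N..real (Suc i) / real N}"
      and y: "\<And>i. i < N \<Longrightarrow> y i \<in> {real i / real N..real (Suc i) / real N}"
    have "1 / d < real N" using N0 N(1) by simp
    hence "1 / real N < d" using d N(2) by (simp add: field_simps)
    hence small: "measure lborel {real i / real N..real (Suc i) / real N} < d" for i
      by (subst measure_lborel_Icc) (auto simp: divide_right_mono diff_divide_distrib[symmetric])
    have near: "\<bar>(\<Sum>i<N. g (z i)) / real N - I\<bar> < e / 2"
      if z: "\<And>i. i < N \<Longrightarrow> z i \<in> {real i / real N..real (Suc i) / real N}" for z
    proof -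
      have "\<forall>(x, K)\<in>(\<lambda>i. (z i, {real i / real N..real (Suc i) / real N})) ` {..<N}. measure lborel K < d"
        by (rule ballI, erule imageE, hypsubst, simp only: prod.case, rule small)
      from mp[OF spec[OF dI] conjI[OF equipartition_tagged_division[OF N(2) z] this]] show ?thesis
        unfolding equipartition_sum[OF N(2)] .
    qed
    define z where "z i = (if g (x i) \<ge> g (y i) then x i else y i)" for i
    define w where "w i = (if g (x i) \<ge> g (y i) then y i else x i)" for i
    have "\<bar>(\<Sum>i<N. g (z i)) / real N - I\<bar> < e / 2"
      by (rule near) (use x y in \<open>auto simp: z_def\<close>)
    moreover have "\<bar>(\<Sum>i<N. g (w i)) / real N - I\<bar> < e / 2"
      by (rule near) (use x y in \<open>auto simp: w_def\<close>)
    ultimately have "(\<Sum>i<N. g (z i)) / real N - (\<Sum>i<N. g (w i)) / real N \<le> e" by linarith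
    hence "((\<Sum>i<N. g (z i)) - (\<Sum>i<N. g (w i))) / real N \<le> e" by (simp add: diff_divide_distrib)
    hence "(\<Sum>i<N. g (z i)) - (\<Sum>i<N. g (w i)) \<le> e * real N" using N(2) by (simp add: field_simps)
    moreover have "(\<Sum>i<N. \<bar>g (x i) - g (y i)\<bar>) = (\<Sum>i<N. g (z i)) - (\<Sum>i<N. g (w i))"
      unfolding sum_subtractf[symmetric] by (intro sum.cong) (auto simp: z_def w_def)
    ultimately show "(\<Sum>i<N. \<bar>g (x i) - g (y i)\<bar>) \<le> e * real N" by simp
  qed
qed

lemma integral_equipartition:
  fixes f :: "real \<Rightarrow> real"
  assumes f: "f integrable_on {0..1}" and N: "N > 0" and k: "k \<le> N"
  shows "integral {0..real k / real N} f = (\<Sum>i<k. integral {real i / real N..real (Suc i) / real N} f)"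
  using k
proof (induction k)
  case (Suc k)
  have le1: "real (Suc k) / real N \<le> 1" using Suc.prems N by (simp add: field_simps)
  have le2: "real k / real N \<le> real (Suc k) / real N" by (simp add: divide_right_mono)
  have "integral {0..real k / real N} f + integral {real k / real N..real (Suc k) / real N} f
      = integral {0..real (Suc k) / real N} f"
    by (rule Henstock_Kurzweil_Integration.integral_combine)
       (use le1 le2 in \<open>auto intro!: integrable_subinterval_real[OF f]\<close>)
  thus ?case using Suc by simp
qed simp

text \<open>If every value lay more than \<open>e\<close> below the average, integrating would give
  an integral smaller than itself. The slack \<open>e\<close> lets a non-strict comparison of
  integrals suffice.\<close>

lemma integral_upper_tag:
  fixes f :: "real \<Rightarrow> real"
  assumes f: "f integrable_on {a..b}" and ab: "a < b" and e: "e > 0"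
  shows "\<exists>x\<in>{a..b}. integral {a..b} f \<le> (b - a) * (f x + e)"
proof (rule ccontr)
  assume "\<not> ?thesis"
  hence *: "(b - a) * (f x + e) < integral {a..b} f" if "x \<in> {a..b}" for x
    using that by (meson not_le)
  let ?c = "integral {a..b} f / (b - a) - e"
  have "((\<lambda>x. ?c) has_integral (b - a) *\<^sub>R ?c) {a..b}" 
    using has_integral_const_real[of ?c a b] ab by simp
  moreover have "f x \<le> ?c" if "x \<in> {a..b}" for x
    using *[OF that] ab by (simp add: field_simps)
  ultimately have "integral {a..b} f \<le> (b - a) *\<^sub>R ?c"
    using has_integral_le[OF integrable_integral[OF f]] by blast
  also have "\<dots> = integral {a..b} f - (b - a) * e" using ab by (simp add: field_simps)
  finally show False using ab e by (simp add: mult_le_0_iff)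
qed

text \<open>On each cell the integral of the product is matched, up to slack, by its value at some
  tag. Oscillation bounds for the two factors then move all tags to the right endpoints. Thus the
  integral \<open>J\<close> may come from a weaker theory than Riemann's.\<close>

lemma product_riemann_sum_tendsto:
  assumes g: "riemann_integrable 0 1 g" and h: "riemann_integrable 0 1 h"
    and bd: "\<And>x. x \<in> {0..1} \<Longrightarrow> \<bar>g x\<bar> \<le> B" "\<And>x. x \<in> {0..1} \<Longrightarrow> \<bar>h x\<bar> \<le> B"
    and J: "((\<lambda>x. g x * h x) has_integral J) {0..1}"
  shows "(\<lambda>N. (\<Sum>i<N. g (real (Suc i) / real N) * h (real (Suc i) / real N)) / real N) \<longlonglongrightarrow> J"
proof (rule LIMSEQ_I)
  fix e :: real assume e: "e > 0"
  have B: "B \<ge> 0" using bd(1)[of 0] by auto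
  \<comment> \<open>Makes the total oscillation \<open>2 * B * e'\<close> of the product at most
    \<open>e / 2\<close>; \<open>B + 1\<close> avoids dividing by zero.\<close>
  define e' where "e' = e / (4 * (B + 1))"
  have e': "e' > 0" unfolding e'_def using e B by simp
  obtain N1 where N1: "\<And>N x y. \<lbrakk>N \<ge> N1; N > 0;
      \<And>i. i < N \<Longrightarrow> x i \<in> {real i / real N..real (Suc i) / real N};
      \<And>i. i < N \<Longrightarrow> y i \<in> {real i / real N..real (Suc i) / real N}\<rbrakk> \<Longrightarrow>
      (\<Sum>i<N. \<bar>g (x i) - g (y i)\<bar>) \<le> e' * real N"
    using riemann_integrable_oscillation[OF g e'] by blast
  obtain N2 where N2: "\<And>N x y. \<lbrakk>N \<ge> N2; N > 0;
      \<And>i. i < N \<Longrightarrow> x i \<in> {real i / real N..real (Suc i) / real N};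
      \<And>i. i < N \<Longrightarrow> y i \<in> {real i / real N..real (Suc i) / real N}\<rbrakk> \<Longrightarrow>
      (\<Sum>i<N. \<bar>h (x i) - h (y i)\<bar>) \<le> e' * real N"
    using riemann_integrable_oscillation[OF h e'] by blast
  define f where "f x = g x * h x" for x
  have f: "f integrable_on {0..1}" and Jf: "integral {0..1} f = J"
    using J unfolding f_def by (auto simp: has_integral_iff)
  have "norm ((\<Sum>i<N. f (real (Suc i) / real N)) / real N - J) < e" if N: "N \<ge> max 1 (max N1 N2)" for N
  proof -
    have N0: "N > 0" using N by simp
    have sub: "{real i / real N..real (Suc i) / real N} \<subseteq> {0..1}" if "i < N" for i
    proof -
      have "real (Suc i) / real N \<le> 1" using that N0 by (simp add: field_simps)
      thus ?thesis by (simp only: atLeastatMost_subset_iff) auto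
    qed
    have fi: "f integrable_on {real i / real N..real (Suc i) / real N}" if "i < N" for i
      by (rule integrable_subinterval_real[OF f sub[OF that]])
    have lt: "real i / real N < real (Suc i) / real N" for i using N0 by (simp add: divide_strict_right_mono)
    have wd: "real (Suc i) / real N - real i / real N = 1 / real N" for i
      by (simp add: diff_divide_distrib[symmetric])
    have JN: "J = (\<Sum>i<N. integral {real i / real N..real (Suc i) / real N} f)"
    proof -
      have "real N / real N = 1" using N0 by simp
      from integral_equipartition[OF f N0 order_refl, unfolded this Jf] show ?thesis .
    qed
    have osc: "(\<Sum>i<N. \<bar>f (x i) - f (real (Suc i) / real N)\<bar>) \<le> e / 2 * real N"
      if x: "\<And>i. i < N \<Longrightarrow> x i \<in> {real i / real N..real (Suc i) / real N}" for x
    proof -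
      define y where "y i = real (Suc i) / real N" for i
      have y: "y i \<in> {real i / real N..real (Suc i) / real N}" for i
        unfolding y_def by (simp add: divide_right_mono)
      have "(\<Sum>i<N. \<bar>f (x i) - f (y i)\<bar>) \<le> (\<Sum>i<N. B * \<bar>g (x i) - g (y i)\<bar> + B * \<bar>h (x i) - h (y i)\<bar>)"
      proof (rule sum_mono)
        fix i assume "i \<in> {..<N}"
        hence "i < N" by simp
        hence xy: "x i \<in> {0..1}" "y i \<in> {0..1}" using subsetD[OF sub x] subsetD[OF sub y] by blast+
        have "f (x i) - f (y i) = h (x i) * (g (x i) - g (y i)) + g (y i) * (h (x i) - h (y i))"
          unfolding f_def by (simp add: algebra_simps)
        also have "\<bar>\<dots>\<bar> \<le> \<bar>h (x i)\<bar> * \<bar>g (x i) - g (y i)\<bar> + \<bar>g (y i)\<bar> * \<bar>h (x i) - h (y i)\<bar>"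
          by (rule order_trans[OF abs_triangle_ineq]) (simp add: abs_mult)
        also have "\<dots> \<le> B * \<bar>g (x i) - g (y i)\<bar> + B * \<bar>h (x i) - h (y i)\<bar>"
          by (intro add_mono mult_right_mono bd xy) auto
        finally show "\<bar>f (x i) - f (y i)\<bar> \<le> B * \<bar>g (x i) - g (y i)\<bar> + B * \<bar>h (x i) - h (y i)\<bar>" .
      qed
      also have "\<dots> = B * (\<Sum>i<N. \<bar>g (x i) - g (y i)\<bar>) + B * (\<Sum>i<N. \<bar>h (x i) - h (y i)\<bar>)"
        by (simp add: sum.distrib sum_distrib_left)
      also have "\<dots> \<le> B * (e' * real N) + B * (e' * real N)"
        by (intro add_mono mult_left_mono B N1 N2 x y) (use N in auto)
      also have "\<dots> = (2 * B * e') * real N" by simp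
      also have "\<dots> \<le> e / 2 * real N"
      proof (rule mult_right_mono)
        have "2 * B * e' \<le> 2 * (B + 1) * e'" using e' by simp
        also have "\<dots> = e / 2" unfolding e'_def using B by (simp add: field_simps)
        finally show "2 * B * e' \<le> e / 2" .
      qed simp
      finally show ?thesis unfolding y_def .
    qed
    \<comment> \<open>With \<open>c\<close> equal to 1 or -1 a single upper estimate gives both
      bounds. Moving the tags costs \<open>e / 2\<close> and choosing them
      \<open>e / 4\<close>.\<close>
    have main: "J' \<le> (\<Sum>i<N. c * f (real (Suc i) / real N)) / real N + (3 / 4) * e"
      if c: "\<bar>c\<bar> = 1" and J': "J' = c * J" for c J'
    proof -
      have "\<exists>x. x \<in> {real i / real N..real (Suc i) / real N} \<and>
          c * integral {real i / real N..real (Suc i) / real N} f \<le> (c * f x + e / 4) / real N" if i: "i < N" for i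
      proof -
        have "(\<lambda>x. c * f x) integrable_on {real i / real N..real (Suc i) / real N}"
          using integrable_cmul[OF fi[OF i], of c] by simp
        from integral_upper_tag[OF this lt, of "e / 4"] e obtain x
          where "x \<in> {real i / real N..real (Suc i) / real N}"
            "integral {real i / real N..real (Suc i) / real N} (\<lambda>x. c * f x) \<le> (1 / real N) * (c * f x + e / 4)"
          unfolding wd by auto
        thus ?thesis by (intro exI[of _ x]) simp
      qed
      then obtain x where x: "\<And>i. i < N \<Longrightarrow> x i \<in> {real i / real N..real (Suc i) / real N}"
        "\<And>i. i < N \<Longrightarrow> c * integral {real i / real N..real (Suc i) / real N} f \<le> (c * f (x i) + e / 4) / real N"
        by metis
      have "J' \<le> (\<Sum>i<N. (c * f (x i) + e / 4) / real N)"
        unfolding J' JN sum_distrib_left by (rule sum_mono) (use x(2) in auto)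
      also have "\<dots> \<le> (\<Sum>i<N. (c * f (real (Suc i) / real N) + \<bar>f (x i) - f (real (Suc i) / real N)\<bar> + e / 4) / real N)"
      proof (intro sum_mono divide_right_mono)
        fix i
        have "c * (f (x i) - f (real (Suc i) / real N)) \<le> \<bar>f (x i) - f (real (Suc i) / real N)\<bar>"
          using c by (metis abs_ge_self abs_mult mult_1)
        thus "c * f (x i) + e / 4 \<le> c * f (real (Suc i) / real N) + \<bar>f (x i) - f (real (Suc i) / real N)\<bar> + e / 4"
          by (simp add: algebra_simps)
      qed simp
      also have "\<dots> = (\<Sum>i<N. c * f (real (Suc i) / real N)) / real N
          + (\<Sum>i<N. \<bar>f (x i) - f (real (Suc i) / real N)\<bar>) / real N + e / 4"
        using N0 by (simp add: sum.distrib add_divide_distrib sum_divide_distrib)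
      also have "(\<Sum>i<N. \<bar>f (x i) - f (real (Suc i) / real N)\<bar>) / real N \<le> e / 2"
        using osc[OF x(1)] N0 by (simp add: field_simps)
      finally show ?thesis by simp
    qed
    let ?S = "(\<Sum>i<N. f (real (Suc i) / real N)) / real N"
    have "J \<le> ?S + (3 / 4) * e" using main[of 1 J] by simp
    moreover have "- J \<le> - ?S + (3 / 4) * e" using main[of "-1" "- J"] by (simp add: sum_negf)
    ultimately have "\<bar>?S - J\<bar> \<le> (3 / 4) * e" by linarith
    thus ?thesis using e by simp
  qed
  thus "\<exists>no. \<forall>N\<ge>no. norm ((\<Sum>i<N. g (real (Suc i) / real N) * h (real (Suc i) / real N)) / real N - J) < e"
    unfolding f_def by blast
qed

text \<open>The product \<open>r a * r b\<close> is Lebesgue integrable, being dominated by the sum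
  of the squares; its Lebesgue integral is therefore also its gauge integral, as the preceding limit
  requires. The tags \<open>Suc i / N\<close> are the sampling points of the kernel.\<close>

lemma orthonormal_gram_tendsto:
  assumes on: "orthonormal_L2 k r"
    and bd: "\<And>i. i \<in> {1..k} \<Longrightarrow> bounded (r i ` {0..1})"
    and ri: "\<And>i. i \<in> {1..k} \<Longrightarrow> riemann_integrable 0 1 (r i)"
    and a: "a \<in> {1..k}" and b: "b \<in> {1..k}"
  shows "(\<lambda>N. (\<Sum>i<N. r a (real (Suc i) / real N) * r b (real (Suc i) / real N)) / real N)
     \<longlonglongrightarrow> (if a = b then 1 else 0)"
proof -
  have meas: "set_borel_measurable lebesgue {0..1} (r i)"
    and sq: "set_integrable lebesgue {0..1} (\<lambda>x. (r i x)\<^sup>2)" if "i \<in> {1..k}" for i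
    using on that unfolding orthonormal_L2_def by auto
  have int: "set_integrable lebesgue {0..1} (\<lambda>x. r a x * r b x)"
  proof -
    have "integrable lebesgue (\<lambda>x. indicator {0..1} x *\<^sub>R (r a x)\<^sup>2 + indicator {0..1} x *\<^sub>R (r b x)\<^sup>2)"
      using sq[OF a] sq[OF b] unfolding set_integrable_def by (rule Bochner_Integration.integrable_add)
    moreover have "(\<lambda>x. (indicator {0..1} x *\<^sub>R r a x) * (indicator {0..1} x *\<^sub>R r b x)) \<in> borel_measurable lebesgue"
      using meas[OF a] meas[OF b] unfolding set_borel_measurable_def by (rule borel_measurable_times)
    hence "(\<lambda>x. indicator {0..1} x *\<^sub>R (r a x * r b x)) \<in> borel_measurable lebesgue"
      by (rule measurable_cong[THEN iffD1, rotated]) (auto simp: indicator_def)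
    moreover have "norm (indicator {0..1} x *\<^sub>R (r a x * r b x))
        \<le> norm (indicator {0..1} x *\<^sub>R (r a x)\<^sup>2 + indicator {0..1} x *\<^sub>R (r b x)\<^sup>2)" for x
    proof -
      have "2 * (\<bar>r a x\<bar> * \<bar>r b x\<bar>) \<le> (r a x)\<^sup>2 + (r b x)\<^sup>2"
        using sum_squares_bound[of "\<bar>r a x\<bar>" "\<bar>r b x\<bar>"] by (simp add: mult.assoc)
      moreover have "0 \<le> \<bar>r a x\<bar> * \<bar>r b x\<bar>" by simp
      ultimately have "\<bar>r a x * r b x\<bar> \<le> (r a x)\<^sup>2 + (r b x)\<^sup>2" unfolding abs_mult by linarith
      thus ?thesis by (auto simp: indicator_def)
    qed
    ultimately show ?thesis unfolding set_integrable_def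
      by (intro Bochner_Integration.integrable_bound[where g = "\<lambda>x. indicator {0..1} x *\<^sub>R (r a x * r b x)"]) auto
  qed
  have J: "((\<lambda>x. r a x * r b x) has_integral (if a = b then 1 else 0)) {0..1}"
    using set_lebesgue_integral_eq_integral[OF int] on a b
    unfolding orthonormal_L2_def by (auto simp: has_integral_iff)
  obtain Ba Bb where "\<forall>y\<in>r a ` {0..1}. norm y \<le> Ba" "\<forall>y\<in>r b ` {0..1}. norm y \<le> Bb"
    using bd[OF a] bd[OF b] unfolding bounded_iff by blast
  hence B: "\<bar>r a x\<bar> \<le> max Ba Bb" "\<bar>r b x\<bar> \<le> max Ba Bb" if "x \<in> {0..1}" for x
    using that by (simp_all add: le_max_iff_disj)
  show ?thesis
    by (rule product_riemann_sum_tendsto[OF ri[OF a] ri[OF b] B J])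
qed

section \<open>Eigenvalues near a low-rank matrix\<close>

text \<open>An entrywise Gram error \<open>\<eta>\<close> changes the form by at most
  \<open>\<eta>\<close> times the squared sum of the \<open>\<bar>c j\<bar>\<close>, which
  Cauchy-Schwarz bounds by \<open>card J\<close> times the sum of squares.\<close>

lemma near_orthogonal_norm:
  fixes \<eta> :: real
  assumes fin: "finite J" and eta: "0 \<le> \<eta>" and n: "n > 0"
    and gram: "\<And>a b. a \<in> J \<Longrightarrow> b \<in> J \<Longrightarrow> \<bar>dot n (v a) (v b) / real n - (if a = b then 1 else 0)\<bar> \<le> \<eta>"
    and y: "y = (\<lambda>s. \<Sum>j\<in>J. c j * v j s)"
  shows "\<bar>dot n y y - real n * (\<Sum>j\<in>J. (c j)\<^sup>2)\<bar> \<le> real n * (card J * \<eta>) * (\<Sum>j\<in>J. (c j)\<^sup>2)"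
proof -
  have gram': "\<bar>dot n (v a) (v b) - real n * (if a = b then 1 else 0)\<bar> \<le> real n * \<eta>" if "a \<in> J" "b \<in> J" for a b
  proof -
    have "dot n (v a) (v b) - real n * (if a = b then 1 else 0)
        = real n * (dot n (v a) (v b) / real n - (if a = b then 1 else 0))"
      using n by (simp add: field_simps)
    thus ?thesis using gram[OF that] by (simp add: abs_mult mult_left_mono)
  qed
  have "dot n y y = (\<Sum>a\<in>J. \<Sum>b\<in>J. c a * c b * dot n (v a) (v b))"
    unfolding y dot_sum_left dot_sum_right by (simp add: sum_distrib_left mult.assoc)
  moreover have "real n * (\<Sum>j\<in>J. (c j)\<^sup>2) = (\<Sum>a\<in>J. \<Sum>b\<in>J. c a * c b * (real n * (if a = b then 1 else 0)))"
    using fin by (simp add: if_distrib[of "(*) _"] sum_distrib_left power2_eq_square mult_ac cong: if_cong)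
  ultimately have "\<bar>dot n y y - real n * (\<Sum>j\<in>J. (c j)\<^sup>2)\<bar>
      = \<bar>\<Sum>a\<in>J. \<Sum>b\<in>J. c a * c b * (dot n (v a) (v b) - real n * (if a = b then 1 else 0))\<bar>"
    by (simp only: sum_subtractf[symmetric] right_diff_distrib)
  also have "\<dots> \<le> (\<Sum>a\<in>J. \<Sum>b\<in>J. \<bar>c a * c b * (dot n (v a) (v b) - real n * (if a = b then 1 else 0))\<bar>)"
    by (rule order_trans[OF sum_abs sum_mono[OF sum_abs]])
  also have "\<dots> \<le> (\<Sum>a\<in>J. \<Sum>b\<in>J. \<bar>c a\<bar> * \<bar>c b\<bar> * (real n * \<eta>))"
    unfolding abs_mult by (intro sum_mono mult_left_mono gram') auto
  also have "\<dots> = (\<Sum>a\<in>J. \<bar>c a\<bar>)\<^sup>2 * (real n * \<eta>)"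
    unfolding power2_eq_square sum_product by (simp add: sum_distrib_right)
  also have "\<dots> \<le> (card J * (\<Sum>j\<in>J. (c j)\<^sup>2)) * (real n * \<eta>)"
  proof (rule mult_right_mono)
    show "(\<Sum>a\<in>J. \<bar>c a\<bar>)\<^sup>2 \<le> card J * (\<Sum>j\<in>J. (c j)\<^sup>2)"
      using Cauchy_Schwarz_ineq_sum[of "\<lambda>_. 1" "\<lambda>a. \<bar>c a\<bar>" J] by simp
  qed (use eta in simp)
  finally show ?thesis by (simp add: mult_ac)
qed

text \<open>Duality: for \<open>y\<close> the combination of the \<open>v j\<close> with
  coefficients \<open>dot n (v j) x\<close>, the left side \<open>S\<close> equals
  \<open>dot n y x\<close>, while the norm estimate bounds \<open>dot n y y\<close> by a multiple of
  \<open>S\<close>. Cauchy-Schwarz then lets one factor \<open>S\<close> cancel.\<close>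

lemma near_orthogonal_Bessel:
  fixes \<eta> :: real
  assumes fin: "finite J" and eta: "0 \<le> \<eta>" and n: "n > 0"
    and gram: "\<And>a b. a \<in> J \<Longrightarrow> b \<in> J \<Longrightarrow> \<bar>dot n (v a) (v b) / real n - (if a = b then 1 else 0)\<bar> \<le> \<eta>"
  shows "(\<Sum>j\<in>J. (dot n (v j) x)\<^sup>2) \<le> real n * (1 + card J * \<eta>) * dot n x x"
proof -
  define S where "S = (\<Sum>j\<in>J. (dot n (v j) x)\<^sup>2)"
  define y where "y = (\<lambda>s. \<Sum>j\<in>J. dot n (v j) x * v j s)"
  have "dot n y y \<le> real n * (1 + card J * \<eta>) * S"
    using near_orthogonal_norm[OF fin eta n gram y_def] unfolding S_def by (simp add: algebra_simps)
  moreover have "dot n y x = S" unfolding y_def dot_sum_left S_def by (simp add: power2_eq_square)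
  ultimately have "S\<^sup>2 \<le> (real n * (1 + card J * \<eta>) * S) * dot n x x"
    using dot_Cauchy_Schwarz[of n y x] dot_nonneg[of n x] by (metis mult_right_mono order_trans)
  hence *: "S * S \<le> S * (real n * (1 + card J * \<eta>) * dot n x x)" by (simp add: power2_eq_square mult_ac)
  show ?thesis
  proof (cases "S > 0")
    case True
    thus ?thesis using * unfolding S_def[symmetric] by (metis mult_le_cancel_left_pos)
  next
    case False
    have "0 \<le> real n * (1 + card J * \<eta>) * dot n x x" using eta dot_nonneg[of n x] by simp
    thus ?thesis using False unfolding S_def[symmetric] by linarith
  qed
qed

text \<open>On the span, \<open>dot n x x\<close> pairs the coefficients with the numbers
  \<open>dot n (v j) x\<close>, and the coefficients are controlled by \<open>x\<close> itself since
  \<open>card J * \<eta> < 1\<close>. That smallness also forces linear independence, hence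
  positivity.\<close>

lemma near_orthogonal_inverse_Bessel:
  fixes \<eta> :: real
  assumes fin: "finite J" and eta: "0 \<le> \<eta>" "card J * \<eta> < 1" and n: "n > 0"
    and gram: "\<And>a b. a \<in> J \<Longrightarrow> b \<in> J \<Longrightarrow> \<bar>dot n (v a) (v b) / real n - (if a = b then 1 else 0)\<bar> \<le> \<eta>"
    and x: "x = (\<lambda>s. \<Sum>j\<in>J. c j * v j s)" and c: "\<exists>j\<in>J. c j \<noteq> 0"
  shows "dot n x x > 0" and "real n * (1 - card J * \<eta>) * dot n x x \<le> (\<Sum>j\<in>J. (dot n (v j) x)\<^sup>2)"
proof -
  define C where "C = (\<Sum>j\<in>J. (c j)\<^sup>2)"
  obtain j where "j \<in> J" "c j \<noteq> 0" using c by blast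
  hence C: "C > 0" unfolding C_def by (intro sum_pos2[OF fin, of j]) auto
  have low: "real n * (1 - card J * \<eta>) * C \<le> dot n x x"
    using near_orthogonal_norm[OF fin eta(1) n gram x] unfolding C_def by (simp add: algebra_simps)
  moreover have "real n * (1 - card J * \<eta>) * C > 0" using C eta n by simp
  ultimately show pos: "dot n x x > 0" by linarith
  have "dot n x x = (\<Sum>j\<in>J. c j * dot n (v j) x)"
    using dot_sum_left[where n = n and L = J and c = c and v = v and y = x] unfolding x[symmetric] .
  hence "(dot n x x)\<^sup>2 \<le> C * (\<Sum>j\<in>J. (dot n (v j) x)\<^sup>2)"
    using Cauchy_Schwarz_ineq_sum[of c "\<lambda>j. dot n (v j) x" J] unfolding C_def by simp
  moreover have "real n * (1 - card J * \<eta>) * C * dot n x x \<le> (dot n x x)\<^sup>2"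
    unfolding power2_eq_square using low pos by (intro mult_right_mono) auto
  ultimately have "C * (real n * (1 - card J * \<eta>) * dot n x x) \<le> C * (\<Sum>j\<in>J. (dot n (v j) x)\<^sup>2)"
    by (simp add: mult_ac)
  thus "real n * (1 - card J * \<eta>) * dot n x x \<le> (\<Sum>j\<in>J. (dot n (v j) x)\<^sup>2)"
    using C by simp
qed

text \<open>The \<open>v j\<close> act as test vectors themselves, so no eigenvectors of the
  low-rank part are computed. Orthogonality to the first \<open>i - 1\<close> of them leaves weights
  at most \<open>\<theta> i\<close>; on the span of the first \<open>i\<close> the weights are at
  least \<open>\<theta> i\<close>, and the remaining terms are nonnegative.\<close>

lemma eigval_near_low_rank:
  fixes A :: "real mat" and \<theta> :: "nat \<Rightarrow> real" and \<eta> :: real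
  assumes A: "A \<in> carrier_mat n n" "transpose_mat A = A"
    and \<theta>: "\<And>i j. 1 \<le> i \<Longrightarrow> i \<le> j \<Longrightarrow> j \<le> k \<Longrightarrow> \<theta> j \<le> \<theta> i" "\<theta> k > 0"
    and i: "1 \<le> i" "i \<le> k" "i \<le> n" and e: "e > 0" and eta: "0 \<le> \<eta>" "k * \<eta> < 1"
    and gram: "\<And>a b. a \<in> {1..k} \<Longrightarrow> b \<in> {1..k} \<Longrightarrow> \<bar>dot n (v a) (v b) / real n - (if a = b then 1 else 0)\<bar> \<le> \<eta>"
    and near: "\<And>x. \<bar>quad n (\<lambda>s t. A $$ (s,t) - e * (\<Sum>j=1..k. \<theta> j * v j s * v j t)) x\<bar> \<le> d * dot n x x"
  shows "\<bar>eigval i A - real n * e * \<theta> i\<bar> \<le> real n * e * \<theta> i * (k * \<eta>) + d"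
proof -
  have n: "n > 0" using i by simp
  have thi: "\<theta> i > 0" using \<theta>(1)[of i k] \<theta>(2) i by simp
  have near': "\<bar>quad n (\<lambda>s t. A $$ (s,t)) x - e * (\<Sum>j=1..k. \<theta> j * (dot n (v j) x)\<^sup>2)\<bar> \<le> d * dot n x x" for x
    using near[of x] unfolding quad_diff quad_scale quad_rank_one_sum .
  have "eigval (Suc (i - 1)) A \<le> real n * e * \<theta> i * (1 + k * \<eta>) + d"
  proof (rule eigval_le[OF A, where v = "\<lambda>l. v (Suc l)"])
    fix x assume x: "\<And>l. l < i - 1 \<Longrightarrow> dot n (v (Suc l)) x = 0"
    have "(\<Sum>j=1..k. \<theta> j * (dot n (v j) x)\<^sup>2) \<le> (\<Sum>j=1..k. \<theta> i * (dot n (v j) x)\<^sup>2)"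
    proof (rule sum_mono)
      fix j assume j: "j \<in> {1..k}"
      show "\<theta> j * (dot n (v j) x)\<^sup>2 \<le> \<theta> i * (dot n (v j) x)\<^sup>2"
      proof (cases "j < i")
        case True
        hence "j - 1 < i - 1" using j by auto
        from x[OF this] have "dot n (v j) x = 0" using j by simp
        thus ?thesis by simp
      next
        case False
        thus ?thesis using \<theta>(1)[of i j] i j by (intro mult_right_mono) auto
      qed
    qed
    also have "\<dots> = \<theta> i * (\<Sum>j=1..k. (dot n (v j) x)\<^sup>2)" by (simp add: sum_distrib_left)
    also have "\<dots> \<le> \<theta> i * (real n * (1 + k * \<eta>) * dot n x x)"
      using near_orthogonal_Bessel[of "{1..k}" \<eta> n v x, OF _ eta(1) n gram] thi by (intro mult_left_mono) auto
    finally have "e * (\<Sum>j=1..k. \<theta> j * (dot n (v j) x)\<^sup>2) \<le> e * (\<theta> i * (real n * (1 + k * \<eta>) * dot n x x))"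
      using e by (intro mult_left_mono) auto
    thus "quad n (\<lambda>s t. A $$ (s,t)) x \<le> (real n * e * \<theta> i * (1 + k * \<eta>) + d) * dot n x x"
      using near'[of x] by (simp add: algebra_simps abs_le_iff)
  qed (use i in simp)
  hence up: "eigval i A \<le> real n * e * \<theta> i * (1 + k * \<eta>) + d" using i by simp
  have "real n * e * \<theta> i * (1 - k * \<eta>) - d \<le> eigval (Suc (i - 1)) A"
  proof (rule eigval_ge[OF A, where v = "\<lambda>l. v (Suc l)"])
    fix c :: "nat \<Rightarrow> real" and x
    assume c: "\<exists>l\<le>i - 1. c l \<noteq> 0" and x0: "x = (\<lambda>s. \<Sum>l\<le>i - 1. c l * v (Suc l) s)"
    have x: "x = (\<lambda>s. \<Sum>j\<in>{1..i}. c (j - 1) * v j s)"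
      unfolding x0
    proof
      fix s
      show "(\<Sum>l\<le>i - 1. c l * v (Suc l) s) = (\<Sum>j\<in>{1..i}. c (j - 1) * v j s)"
        by (rule sum.reindex_bij_witness[where i = "\<lambda>j. j - 1" and j = Suc]) (use i in auto)
    qed
    have c': "\<exists>j\<in>{1..i}. c (j - 1) \<noteq> 0"
    proof -
      obtain l where "l \<le> i - 1" "c l \<noteq> 0" using c by blast
      thus ?thesis using i by (intro bexI[of _ "Suc l"]) auto
    qed
    \<comment> \<open>The lower bound involves just \<open>i\<close> of the vectors; its Gram error
      is enlarged to match the upper bound.\<close>
    have le: "real i * \<eta> \<le> k * \<eta>" using i eta(1) by (intro mult_right_mono) auto
    have gram': "\<bar>dot n (v a) (v b) / real n - (if a = b then 1 else 0)\<bar> \<le> \<eta>"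
      if "a \<in> {1..i}" "b \<in> {1..i}" for a b using that i by (intro gram) auto
    have small: "real (card {1..i}) * \<eta> < 1" using le eta(2) by simp
    note inv = near_orthogonal_inverse_Bessel[OF _ eta(1) small n gram' x c']
    have pos: "dot n x x > 0" by (rule inv(1)) auto
    have "real n * (1 - k * \<eta>) * dot n x x \<le> real n * (1 - i * \<eta>) * dot n x x"
      using le pos by (intro mult_right_mono mult_left_mono) auto
    also have "\<dots> \<le> (\<Sum>j=1..i. (dot n (v j) x)\<^sup>2)" using inv(2) by simp
    finally have "\<theta> i * (real n * (1 - k * \<eta>) * dot n x x) \<le> \<theta> i * (\<Sum>j=1..i. (dot n (v j) x)\<^sup>2)"
      using thi by (intro mult_left_mono) auto
    also have "\<dots> \<le> (\<Sum>j=1..i. \<theta> j * (dot n (v j) x)\<^sup>2)"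
      unfolding sum_distrib_left using \<theta>(1) i by (intro sum_mono mult_right_mono) auto
    also have "\<dots> \<le> (\<Sum>j=1..k. \<theta> j * (dot n (v j) x)\<^sup>2)"
    proof (rule sum_mono2)
      fix j assume "j \<in> {1..k} - {1..i}"
      hence "\<theta> j > 0" using \<theta>(1)[of j k] \<theta>(2) by auto
      thus "0 \<le> \<theta> j * (dot n (v j) x)\<^sup>2" by simp
    qed (use i in auto)
    finally have "e * (\<theta> i * (real n * (1 - k * \<eta>) * dot n x x)) \<le> e * (\<Sum>j=1..k. \<theta> j * (dot n (v j) x)\<^sup>2)"
      using e by (intro mult_left_mono) auto
    hence "(real n * e * \<theta> i * (1 - k * \<eta>) - d) * dot n x x \<le> quad n (\<lambda>s t. A $$ (s,t)) x"
      using near'[of x] by (simp add: algebra_simps abs_le_iff)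
    thus "dot n x x > 0 \<and> (real n * e * \<theta> i * (1 - k * \<eta>) - d) * dot n x x \<le> quad n (\<lambda>s t. A $$ (s,t)) x"
      using pos by blast
  qed (use i in simp)
  hence "real n * e * \<theta> i * (1 - k * \<eta>) - d \<le> eigval i A" using i by simp
  thus ?thesis using up by (simp add: algebra_simps abs_le_iff)
qed

section \<open>Random symmetric Bernoulli matrices\<close>

text \<open>Serves to move independence from the index pairs counted from 1 to matrix positions
  counted from 0.\<close>

lemma (in prob_space) indep_vars_reindex:
  assumes "indep_vars M' X I" and inj: "inj_on f J" and sub: "f ` J \<subseteq> I"
  shows "indep_vars (\<lambda>j. M' (f j)) (\<lambda>j. X (f j)) J"
proof -
  define F where "F i = {X i -` A \<inter> space M |A. A \<in> sets (M' i)}" for i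
  have rv: "\<forall>i\<in>I. random_variable (M' i) (X i)" and F: "indep_sets F I"
    using assms(1) unfolding indep_vars_def2 F_def by auto
  have "indep_sets (\<lambda>j. F (f j)) J"
    unfolding indep_sets_def
  proof (intro conjI ballI allI impI)
    fix j assume "j \<in> J"
    thus "F (f j) \<subseteq> events" using F sub unfolding indep_sets_def by blast
  next
    fix K A assume K: "K \<subseteq> J" "K \<noteq> {}" "finite K" and A: "A \<in> (\<Pi> j\<in>K. F (f j))"
    define B where "B i = A (inv_into K f i)" for i
    have inj': "inj_on f K" using inj K(1) by (rule inj_on_subset)
    have B: "B (f j) = A j" if "j \<in> K" for j
      unfolding B_def using inv_into_f_f[OF inj' that] by simp
    have "B \<in> Pi (f ` K) F" using A B by auto
    moreover have "f ` K \<subseteq> I" "f ` K \<noteq> {}" "finite (f ` K)" using K sub by auto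
    ultimately have "prob (\<Inter>i\<in>f ` K. B i) = (\<Prod>i\<in>f ` K. prob (B i))"
      using F unfolding indep_sets_def by blast
    also have "(\<Prod>i\<in>f ` K. prob (B i)) = (\<Prod>j\<in>K. prob (A j))"
      using B by (simp add: prod.reindex[OF inj'])
    finally show "prob (\<Inter>j\<in>K. A j) = (\<Prod>j\<in>K. prob (A j))" using B by simp
  qed
  thus ?thesis using rv sub unfolding indep_vars_def2 F_def by auto
qed

section \<open>Moments of centred Bernoulli variables\<close>

lemma (in prob_space) bernoulli_centered_moments:
  fixes X :: "'a \<Rightarrow> real"
  assumes X: "random_variable borel X"
    and dist: "distr M borel X = distr (measure_pmf (bernoulli_pmf p)) borel of_bool"
    and p: "0 \<le> p" "p \<le> 1"
  shows "integrable M (\<lambda>\<omega>. (X \<omega> - p) ^ k)"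
    and "expectation (\<lambda>\<omega>. (X \<omega> - p) ^ k) = (1 - p) ^ k * p + (- p) ^ k * (1 - p)"
proof -
  let ?f = "\<lambda>x :: real. (x - p) ^ k"
  have f: "?f \<in> borel_measurable borel" by simp
  have b: "(of_bool :: bool \<Rightarrow> real) \<in> measurable (measure_pmf (bernoulli_pmf p)) borel" by simp
  have "integrable (distr (measure_pmf (bernoulli_pmf p)) borel of_bool) ?f"
    unfolding integrable_distr_eq[OF b f] by (rule integrable_measure_pmf_finite) simp
  thus "integrable M (\<lambda>\<omega>. (X \<omega> - p) ^ k)"
    unfolding dist[symmetric] integrable_distr_eq[OF X f] .
  have "expectation (\<lambda>\<omega>. (X \<omega> - p) ^ k) = integral\<^sup>L (distr M borel X) ?f"
    by (rule integral_distr[OF X f, symmetric])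
  also have "\<dots> = (\<integral>x. ?f (of_bool x) \<partial>measure_pmf (bernoulli_pmf p))"
    unfolding dist by (rule integral_distr[OF b f])
  also have "\<dots> = (1 - p) ^ k * p + (- p) ^ k * (1 - p)" using p by simp
  finally show "expectation (\<lambda>\<omega>. (X \<omega> - p) ^ k) = (1 - p) ^ k * p + (- p) ^ k * (1 - p)" .
qed

text \<open>Replacing \<open>(1-p)^k\<close> by \<open>1-p\<close> and \<open>p^k\<close> by
  \<open>p^2\<close> leaves \<open>p * (1 - p^2)\<close>. The bound is uniform in \<open>k\<close>,
  so an edge costs the same however often it is traversed.\<close>

lemma bernoulli_centered_moment_le:
  fixes p :: real
  assumes p: "0 \<le> p" "p \<le> 1" and k: "k \<ge> 2"
  shows "\<bar>(1 - p) ^ k * p + (- p) ^ k * (1 - p)\<bar> \<le> p"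
proof -
  have k1: "k \<ge> 1" using k by simp
  have "\<bar>(1 - p) ^ k * p + (- p) ^ k * (1 - p)\<bar> \<le> (1 - p) ^ k * p + p ^ k * (1 - p)"
    using p by (intro order_trans[OF abs_triangle_ineq]) (simp add: abs_mult power_abs)
  also have "\<dots> \<le> (1 - p) ^ 1 * p + p ^ 1 * (1 - p) * p"
  proof (intro add_mono)
    show "(1 - p) ^ k * p \<le> (1 - p) ^ 1 * p"
      using p k1 by (intro mult_right_mono power_decreasing) auto
    have "p ^ k \<le> p ^ 2" using p k by (intro power_decreasing) auto
    hence "p ^ k * (1 - p) \<le> p ^ 2 * (1 - p)" using p by (intro mult_right_mono) auto
    thus "p ^ k * (1 - p) \<le> p ^ 1 * (1 - p) * p" by (simp add: power2_eq_square mult_ac)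
  qed
  also have "\<dots> = p * (1 - p\<^sup>2)" by (simp add: algebra_simps power2_eq_square)
  also have "\<dots> \<le> p" using p by (simp add: mult_left_le)
  finally show ?thesis .
qed

lemma bernoulli_sym_matrix_eigval_measurable:
  assumes M: "prob_space M" and A: "bernoulli_sym_matrix M n p A" and i: "1 \<le> i" "i \<le> n"
  shows "(\<lambda>\<omega>. eigval i (A \<omega>)) \<in> borel_measurable M"
proof -
  interpret prob_space M by fact
  have ind: "indep_vars (\<lambda>_. borel) (\<lambda>(i, j) \<omega>. A \<omega> $$ (i - 1, j - 1)) {(i, j). 1 \<le> i \<and> i \<le> j \<and> j \<le> n}"
    using A unfolding bernoulli_sym_matrix_def by auto
  have "(\<lambda>\<omega>. A \<omega> $$ (s, t)) \<in> borel_measurable M" if "s \<le> t" "t < n" for s t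
  proof -
    have "(Suc s, Suc t) \<in> {(i, j). 1 \<le> i \<and> i \<le> j \<and> j \<le> n}" using that by simp
    hence "random_variable borel (case (Suc s, Suc t) of (i, j) \<Rightarrow> \<lambda>\<omega>. A \<omega> $$ (i - 1, j - 1))"
      using ind unfolding indep_vars_def2 by blast
    thus ?thesis by simp
  qed
  hence "(\<lambda>\<omega>. eigval (Suc (i - 1)) (A \<omega>)) \<in> borel_measurable M"
    using A i unfolding bernoulli_sym_matrix_def by (intro borel_measurable_eigval[where n = n]) auto
  thus ?thesis using i by simp
qed

lemma bernoulli_sym_matrix_spectral_deviation:
  fixes A :: "'a \<Rightarrow> real mat" and d q :: real
  assumes M: "prob_space M" and A: "bernoulli_sym_matrix M n p A"
    and psym: "\<And>i j. p i j = p j i"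
    and p: "\<And>i j. 1 \<le> i \<Longrightarrow> i \<le> j \<Longrightarrow> j \<le> n \<Longrightarrow> 0 \<le> p i j \<and> p i j \<le> q"
    and q: "0 \<le> q" "q \<le> 1" "1 \<le> real n * q" and d: "d > 0" and m: "m > 0"
    and E: "E \<in> sets M"
    and imp: "\<And>\<omega>. \<omega> \<in> space M \<Longrightarrow>
      (\<And>x. \<bar>quad n (\<lambda>s t. A \<omega> $$ (s,t) - p (Suc s) (Suc t)) x\<bar> \<le> d * dot n x x) \<Longrightarrow> \<omega> \<in> E"
  shows "measure M (space M - E) \<le> real n * real (Suc m) ^ (2 * m + 2) * (real n * q) ^ m / d ^ (2 * m)"
proof -
  interpret prob_space M by fact
  have carr: "A \<omega> \<in> carrier_mat n n" "transpose_mat (A \<omega>) = A \<omega>" if "\<omega> \<in> space M" for \<omega>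
    using A that unfolding bernoulli_sym_matrix_def by auto
  have ind0: "indep_vars (\<lambda>_. borel) (\<lambda>(i, j) \<omega>. A \<omega> $$ (i - 1, j - 1)) {(i, j). 1 \<le> i \<and> i \<le> j \<and> j \<le> n}"
    using A unfolding bernoulli_sym_matrix_def by auto
  have dist: "distr M borel (\<lambda>\<omega>. A \<omega> $$ (s, t)) = distr (measure_pmf (bernoulli_pmf (p (Suc s) (Suc t)))) borel of_bool"
    if "s \<le> t" "t < n" for s t
  proof -
    have "1 \<le> Suc s \<and> Suc s \<le> Suc t \<and> Suc t \<le> n" using that by simp
    hence "distr M borel (\<lambda>\<omega>. A \<omega> $$ (Suc s - 1, Suc t - 1))
        = distr (measure_pmf (bernoulli_pmf (p (Suc s) (Suc t)))) borel of_bool"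
      using A unfolding bernoulli_sym_matrix_def by blast
    thus ?thesis by simp
  qed
  define I where "I = {(s :: nat, t). s \<le> t \<and> t < n}"
  define f where "f = (\<lambda>(s :: nat, t :: nat). (Suc s, Suc t))"
  have "indep_vars (\<lambda>_. borel) (\<lambda>e. (\<lambda>(i, j) \<omega>. A \<omega> $$ (i - 1, j - 1)) (f e)) I"
    by (rule indep_vars_reindex[OF ind0]) (auto simp: f_def I_def inj_on_def)
  hence indA: "indep_vars (\<lambda>_. borel) (\<lambda>(s, t) \<omega>. A \<omega> $$ (s, t)) I"
    by (simp add: f_def case_prod_unfold)
  have rv: "random_variable borel (\<lambda>\<omega>. A \<omega> $$ (s, t))" if "s \<le> t" "t < n" for s t
    using indA that unfolding indep_vars_def2 I_def by auto
  define w where "w s t \<omega> = A \<omega> $$ (s, t) - p (Suc s) (Suc t)" for s t \<omega>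
  have "indep_vars (\<lambda>_. borel) (\<lambda>e \<omega>. (case e of (s, t) \<Rightarrow> \<lambda>\<omega>. A \<omega> $$ (s, t)) \<omega> - p (Suc (fst e)) (Suc (snd e))) I"
    by (rule indep_vars_compose2[OF indA]) simp
  hence indw: "indep_vars (\<lambda>_. borel) (\<lambda>(s, t). w s t) {(s, t). s \<le> t \<and> t < n}"
    unfolding I_def w_def[abs_def] by (simp add: case_prod_unfold)
  have wsym: "w s t \<omega> = w t s \<omega>" if "s < n" "t < n" "\<omega> \<in> space M" for s t \<omega>
    using arg_cong[OF carr(2)[OF that(3)], of "\<lambda>B. B $$ (s,t)"] carr(1)[OF that(3)] that psym[of "Suc s" "Suc t"]
    unfolding w_def by auto
  have p01: "0 \<le> p (Suc s) (Suc t)" "p (Suc s) (Suc t) \<le> 1" "p (Suc s) (Suc t) \<le> q" if "s \<le> t" "t < n" for s t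
    using p[of "Suc s" "Suc t"] that q by auto
  have int: "integrable M (\<lambda>\<omega>. w s t \<omega> ^ k)" if "s \<le> t" "t < n" for s t k
    unfolding w_def by (rule bernoulli_centered_moments(1)[OF rv dist p01(1,2)]) (use that in auto)
  have mom: "expectation (\<lambda>\<omega>. w s t \<omega> ^ k) = (1 - p (Suc s) (Suc t)) ^ k * p (Suc s) (Suc t)
      + (- p (Suc s) (Suc t)) ^ k * (1 - p (Suc s) (Suc t))" if "s \<le> t" "t < n" for s t k
    unfolding w_def by (rule bernoulli_centered_moments(2)[OF rv dist p01(1,2)]) (use that in auto)
  have mean: "expectation (w s t) = 0" if "s \<le> t" "t < n" for s t
    using mom[OF that, of 1] by (simp add: algebra_simps)
  have var: "\<bar>expectation (\<lambda>\<omega>. w s t \<omega> ^ k)\<bar> \<le> q" if "s \<le> t" "t < n" "k \<ge> 2" for s t k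
    unfolding mom[OF that(1,2)]
    using bernoulli_centered_moment_le[OF p01(1,2)[OF that(1,2)] that(3)] p01(3)[OF that(1,2)] by linarith
  define T where "T \<omega> = (\<Sum>s<n. walk_pow n (\<lambda>s t. w s t \<omega>) (2 * m) s s)" for \<omega>
  have intT: "integrable M T"
    unfolding T_def[abs_def] by (rule expectation_trace_le(1)[OF wsym indw int mean var q])
  have ET: "expectation T \<le> real n * real (Suc m) ^ (2 * m + 2) * (real n * q) ^ m"
    unfolding T_def[abs_def] by (rule expectation_trace_le(2)[OF wsym indw int mean var q])
  have Tmeas: "T \<in> borel_measurable M" using intT by auto
  have sub: "space M - E \<subseteq> {\<omega> \<in> space M. T \<omega> \<ge> d ^ (2 * m)}"
  proof (rule subsetI, rule ccontr)
    fix \<omega> assume "\<omega> \<in> space M - E" and "\<omega> \<notin> {\<omega> \<in> space M. T \<omega> \<ge> d ^ (2 * m)}"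
    hence \<omega>: "\<omega> \<in> space M" "\<omega> \<notin> E" "T \<omega> \<le> d ^ (2 * m)" by auto
    have "\<bar>quad n (\<lambda>s t. w s t \<omega>) x\<bar> \<le> d * dot n x x" for x
      by (rule quad_le_trace[OF _ _ m]) (use \<omega> d wsym in \<open>auto simp: T_def\<close>)
    thus False using imp[OF \<omega>(1)] \<omega>(2) unfolding w_def by blast
  qed
  have Tnn: "T \<omega> \<ge> 0" if "\<omega> \<in> space M" for \<omega>
    unfolding T_def by (rule trace_even_power_nonneg) (use wsym that in auto)
  have "measure M (space M - E) \<le> measure M {\<omega> \<in> space M. T \<omega> \<ge> d ^ (2 * m)}"
    using sub Tmeas by (intro finite_measure_mono) measurable
  also have "\<dots> \<le> expectation T / d ^ (2 * m)"
    by (rule integral_Markov_inequality_measure[OF intT, of "{}"]) (use Tnn d in auto)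
  also have "\<dots> \<le> real n * real (Suc m) ^ (2 * m + 2) * (real n * q) ^ m / d ^ (2 * m)"
    using ET d by (intro divide_right_mono) auto
  finally show ?thesis .
qed

lemma trace_moment_bound_eventually:
  fixes S c :: real
  assumes S: "S > 0" and c: "c > 0"
  shows "\<forall>\<^sub>F t in at_top. \<forall>n x m. n = exp t \<longrightarrow> t ^ 8 \<le> x \<longrightarrow> m = nat \<lceil>t\<^sup>2\<rceil> \<longrightarrow>
           m > 0 \<and> 1 \<le> x * S \<and>
           n * real (Suc m) ^ (2 * m + 2) * (x * S) ^ m / (x * c) ^ (2 * m) \<le> exp (- (t\<^sup>2))"
proof -
  have 1: "\<forall>\<^sub>F t in at_top. 1 \<le> t ^ 8 * S" using S by real_asymp
  have "((\<lambda>t :: real. (t\<^sup>2 + 2)\<^sup>2 * S / (c\<^sup>2 * t ^ 8)) \<longlongrightarrow> 0) at_top" using S c by real_asymp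
  hence 2: "\<forall>\<^sub>F t in at_top. (t\<^sup>2 + 2)\<^sup>2 * S / (c\<^sup>2 * t ^ 8) < exp (- 2)"
    by (rule order_tendstoD) simp
  have 3: "\<forall>\<^sub>F t :: real in at_top. exp t * (t\<^sup>2 + 2)\<^sup>2 * exp (- (2 * t\<^sup>2)) \<le> exp (- (t\<^sup>2))"
    by real_asymp
  have 4: "\<forall>\<^sub>F t :: real in at_top. t \<ge> 1" by (rule eventually_ge_at_top)
  from 1 2 3 4 show ?thesis
  proof eventually_elim
    case (elim t)
    show ?case
    proof (intro allI impI)
      fix n x :: real and m :: nat
      assume n: "n = exp t" and x: "t ^ 8 \<le> x" and m: "m = nat \<lceil>t\<^sup>2\<rceil>"
      have t: "t ^ 8 > 0" "t\<^sup>2 > 0" using elim(4) by auto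
      have x0: "x > 0" using x t by linarith
      have m1: "t\<^sup>2 \<le> real m" and m2: "real m \<le> t\<^sup>2 + 1" unfolding m using t(2) by linarith+
      have "m > 0" unfolding m using t(2) by simp
      have xS: "1 \<le> x * S" using elim(1) x S mult_right_mono[of "t ^ 8" x S] by linarith
      define \<rho> where "\<rho> = (real (Suc m))\<^sup>2 * S / (c\<^sup>2 * x)"
      have "(real (Suc m))\<^sup>2 \<le> (t\<^sup>2 + 2)\<^sup>2" using m2 by (intro power_mono) auto
      hence "\<rho> \<le> (t\<^sup>2 + 2)\<^sup>2 * S / (c\<^sup>2 * t ^ 8)"
        unfolding \<rho>_def using S c x t by (intro frac_le mult_right_mono mult_left_mono) auto
      hence \<rho>: "0 \<le> \<rho>" "\<rho> \<le> exp (- 2)" using elim(2) S x0 unfolding \<rho>_def by auto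
      have "n * real (Suc m) ^ (2 * m + 2) * (x * S) ^ m / (x * c) ^ (2 * m)
          = n * (real (Suc m))\<^sup>2 * (((real (Suc m))\<^sup>2) ^ m * (x * S) ^ m / ((x * c)\<^sup>2) ^ m)"
      proof -
        have "real (Suc m) ^ (2 * m + 2) = (real (Suc m))\<^sup>2 * ((real (Suc m))\<^sup>2) ^ m"
          unfolding power_add power_mult by (rule mult.commute)
        thus ?thesis unfolding power_mult by simp
      qed
      also have "\<dots> = n * (real (Suc m))\<^sup>2 * ((real (Suc m))\<^sup>2 * (x * S) / (x * c)\<^sup>2) ^ m"
        by (simp only: power_mult_distrib power_divide)
      also have "(real (Suc m))\<^sup>2 * (x * S) / (x * c)\<^sup>2 = \<rho>"
        unfolding \<rho>_def using x0 c by (simp add: field_simps power2_eq_square)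
      also have "n * (real (Suc m))\<^sup>2 * \<rho> ^ m \<le> exp t * (t\<^sup>2 + 2)\<^sup>2 * exp (- (2 * t\<^sup>2))"
      proof (intro mult_mono)
        show "(real (Suc m))\<^sup>2 \<le> (t\<^sup>2 + 2)\<^sup>2" by fact
        have "\<rho> ^ m \<le> exp (- 2) ^ m" using \<rho> by (intro power_mono)
        also have "\<dots> = exp (- 2 * real m)" by (simp add: exp_of_nat_mult[symmetric] mult.commute)
        also have "\<dots> \<le> exp (- (2 * t\<^sup>2))" using m1 by simp
        finally show "\<rho> ^ m \<le> exp (- (2 * t\<^sup>2))" .
      qed (use n \<rho>(1) in auto)
      also have "\<dots> \<le> exp (- (t\<^sup>2))" by (rule elim(3))
      finally show "m > 0 \<and> 1 \<le> x * S \<and>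
           n * real (Suc m) ^ (2 * m + 2) * (x * S) ^ m / (x * c) ^ (2 * m) \<le> exp (- (t\<^sup>2))"
        using \<open>m > 0\<close> xS by blast
    qed
  qed
qed

section \<open>The kernel and the final assembly\<close>

lemma kernel_fun_commute: "kernel_fun k \<theta> r x y = kernel_fun k \<theta> r y x"
  unfolding kernel_fun_def by (simp add: mult_ac)

text \<open>A real \<open>SUP\<close> is an upper bound only for sets bounded above, which
  boundedness of the \<open>r i\<close> guarantees.\<close>

lemma kernel_fun_le_Sup:
  assumes bd: "\<And>i. i \<in> {1..k} \<Longrightarrow> bounded (r i ` {0..1})" and x: "x \<in> {0..1}" and y: "y \<in> {0..1}"
  shows "kernel_fun k \<theta> r x y \<le> (SUP (x, y)\<in>{0..1} \<times> {0..1}. kernel_fun k \<theta> r x y)"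
proof -
  have "bounded (\<Union>i\<in>{1..k}. r i ` {0..1})" using bd by (intro bounded_UN) auto
  then obtain B where B: "\<And>i x. i \<in> {1..k} \<Longrightarrow> x \<in> {0..1} \<Longrightarrow> \<bar>r i x\<bar> \<le> B"
    unfolding bounded_iff by fastforce
  have "kernel_fun k \<theta> r x y \<le> (\<Sum>i=1..k. \<bar>\<theta> i\<bar> * B * B)" if "x \<in> {0..1}" "y \<in> {0..1}" for x y
    unfolding kernel_fun_def
  proof (rule sum_mono)
    fix i assume i: "i \<in> {1..k}"
    have "\<theta> i * r i x * r i y \<le> \<bar>\<theta> i\<bar> * \<bar>r i x\<bar> * \<bar>r i y\<bar>"
      by (metis abs_ge_self abs_mult)
    also have "\<dots> \<le> \<bar>\<theta> i\<bar> * B * B"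
      using B[OF i that(1)] B[OF i that(2)] by (intro mult_mono) auto
    finally show "\<theta> i * r i x * r i y \<le> \<bar>\<theta> i\<bar> * B * B" .
  qed
  hence "bdd_above ((\<lambda>(x, y). kernel_fun k \<theta> r x y) ` ({0..1} \<times> {0..1}))"
    by (intro bdd_aboveI[of _ "\<Sum>i=1..k. \<bar>\<theta> i\<bar> * B * B"]) auto
  from cSUP_upper[OF _ this, of "(x, y)"] show ?thesis using x y by auto
qed

theorem theorem2p1:
  fixes k :: nat and \<theta> :: "nat \<Rightarrow> real" and r :: "nat \<Rightarrow> real \<Rightarrow> real"
    and \<epsilon> :: "nat \<Rightarrow> real" and \<epsilon>_inf \<xi> :: real
    and M :: "nat \<Rightarrow> 'a measure" and A :: "nat \<Rightarrow> 'a \<Rightarrow> real mat"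
  assumes "k \<ge> 1"
    and "\<And>i j. 1 \<le> i \<Longrightarrow> i \<le> j \<Longrightarrow> j \<le> k \<Longrightarrow> \<theta> j \<le> \<theta> i" and "\<theta> k > 0"
    and "orthonormal_L2 k r"
    and "\<And>x y. x \<in> {0..1} \<Longrightarrow> y \<in> {0..1} \<Longrightarrow> kernel_fun k \<theta> r x y \<ge> 0"
    and "\<And>N. N \<ge> 1 \<Longrightarrow> 0 < \<epsilon> N \<and>
           \<epsilon> N \<le> inverse (SUP (x, y)\<in>{0..1} \<times> {0..1}. kernel_fun k \<theta> r x y)"
    and "\<And>N. N \<ge> 1 \<Longrightarrow> prob_space (M N)"
    and "\<And>N. N \<ge> 1 \<Longrightarrow> bernoulli_sym_matrix (M N) N
           (\<lambda>i j. \<epsilon> N * kernel_fun k \<theta> r (real i / real N) (real j / real N)) (A N)"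
    and "\<And>i. i \<in> {1..k} \<Longrightarrow> bounded (r i ` {0..1})"
    and "\<And>i. i \<in> {1..k} \<Longrightarrow> riemann_integrable 0 1 (r i)"
    and "\<xi> > 8"
    and "(\<lambda>N. inverse (real N * \<epsilon> N) * ln (real N) powr \<xi>) \<longlonglongrightarrow> 0"
    and "\<epsilon>_inf \<ge> 0" and "\<epsilon> \<longlonglongrightarrow> \<epsilon>_inf"
  shows "\<forall>i\<in>{1..k}. \<exists>Y :: nat \<Rightarrow> 'a \<Rightarrow> real.
           (\<forall>N\<ge>i. Y N \<in> borel_measurable (M N)) \<and>
           small_o_hp M Y (\<lambda>_ _. 1) \<and>
           (\<forall>N\<ge>i. \<forall>\<omega>\<in>space (M N).
              eigval i (A N \<omega>) = real N * \<epsilon> N * \<theta> i * (1 + Y N \<omega>))"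
proof
  fix i assume i: "i \<in> {1..k}"
  note \<theta> = assms(2,3) and bern = assms(8)
  define f where "f = kernel_fun k \<theta> r"
  define S where "S = (SUP (x, y)\<in>{0..1} \<times> {0..1}. f x y)"
  define p where "p N i j = \<epsilon> N * f (real i / real N) (real j / real N)" for N i j
  have eps: "\<epsilon> N > 0" if "N \<ge> 1" for N using assms(6)[OF that] by simp
  \<comment> \<open>Positivity comes from \<open>\<epsilon> 1\<close>, which is positive and at most
    the inverse of the supremum.\<close>
  have S: "S > 0"
    using assms(6)[of 1] unfolding S_def f_def by (metis inverse_positive_iff_positive le_numeral_extra(4) order_less_le_trans)
  \<comment> \<open>The number \<open>\<epsilon> N * S\<close> bounds all edge probabilities, and so
    acts as the \<open>q\<close> of the moment estimate.\<close>
  have epsS: "\<epsilon> N * S \<le> 1" if "N \<ge> 1" for N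
  proof -
    have "\<epsilon> N \<le> inverse S" using assms(6)[OF that] unfolding S_def f_def by simp
    hence "\<epsilon> N * S \<le> inverse S * S" using S by (intro mult_right_mono) auto
    thus ?thesis using S by simp
  qed
  have fS: "0 \<le> f x y \<and> f x y \<le> S" if "x \<in> {0..1}" "y \<in> {0..1}" for x y
    using kernel_fun_le_Sup[OF assms(9) that] assms(5)[OF that] unfolding S_def f_def by simp
  have bernN: "bernoulli_sym_matrix (M N) N (p N) (A N)" if "N \<ge> 1" for N
    using bern[OF that] unfolding p_def[abs_def] f_def .
  have thi: "\<theta> i > 0" using \<theta>(1)[of i k] \<theta>(2) i by auto
  \<comment> \<open>The required identity forces this relative error; what remains is to show that
    it is small.\<close>
  define Y where "Y N \<omega> = eigval i (A N \<omega>) / (real N * \<epsilon> N * \<theta> i) - 1" for N \<omega>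
  have meas: "Y N \<in> borel_measurable (M N)" if "N \<ge> i" for N
  proof -
    have "N \<ge> 1" using that i by simp
    from bernoulli_sym_matrix_eigval_measurable[OF assms(7)[OF this] bernN[OF this]] that i
    have "(\<lambda>\<omega>. eigval i (A N \<omega>)) \<in> borel_measurable (M N)" by simp
    thus ?thesis unfolding Y_def[abs_def] by measurable
  qed
  have "whp M (\<lambda>N. {\<omega> \<in> space (M N). \<bar>Y N \<omega>\<bar> \<le> \<delta> * \<bar>1\<bar>})" if \<delta>: "\<delta> > 0" for \<delta>
  proof -
    define E where "E N = {\<omega> \<in> space (M N). \<bar>Y N \<omega>\<bar> \<le> \<delta> * \<bar>1\<bar>}" for N
    have Esets: "E N \<in> sets (M N)" if "N \<ge> i" for N
    proof -
      note [measurable] = meas[OF that]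
      show ?thesis unfolding E_def by measurable
    qed
    \<comment> \<open>The Gram error \<open>k * \<eta>\<close> receives half of
      \<open>\<delta>\<close>; the cap \<open>1 / 2\<close> keeps \<open>k * \<eta> < 1\<close>, as
      the lower eigenvalue bound demands.\<close>
    define \<eta> where "\<eta> = min (\<delta> / 2) (1 / 2) / real k"
    have k\<eta>: "k * \<eta> = min (\<delta> / 2) (1 / 2)" unfolding \<eta>_def using assms(1) by simp
    have \<eta>: "\<eta> > 0" unfolding \<eta>_def using \<delta> assms(1) by simp
    define v where "v N j s = r j (real (Suc s) / real N)" for N j s
    have "\<forall>\<^sub>F N in sequentially. \<bar>dot N (v N (fst ab)) (v N (snd ab)) / real N - (if fst ab = snd ab then 1 else 0)\<bar> < \<eta>"
      if "ab \<in> {1..k} \<times> {1..k}" for ab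
    proof -
      have "(\<lambda>N. dot N (v N (fst ab)) (v N (snd ab)) / real N) \<longlonglongrightarrow> (if fst ab = snd ab then 1 else 0)"
        unfolding dot_def v_def
        by (rule orthonormal_gram_tendsto[OF assms(4) assms(9) assms(10)]) (use that in auto)
      from tendstoD[OF this \<eta>] show ?thesis unfolding dist_real_def .
    qed
    hence ev1: "\<forall>\<^sub>F N in sequentially. \<forall>ab\<in>{1..k} \<times> {1..k}.
        \<bar>dot N (v N (fst ab)) (v N (snd ab)) / real N - (if fst ab = snd ab then 1 else 0)\<bar> < \<eta>"
      by (intro eventually_ball_finite) auto
    have ln_lim: "filterlim (\<lambda>N. ln (real N)) at_top sequentially" by real_asymp
    \<comment> \<open>The noise receives the other half: \<open>x * c\<close> is
      \<open>\<delta> / 2\<close> times the predicted eigenvalue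
      \<open>x * \<theta> i\<close>.\<close>
    define c where "c = \<theta> i * \<delta> / 2"
    have c: "c > 0" unfolding c_def using thi \<delta> by simp
    note ev2 = eventually_compose_filterlim[OF trace_moment_bound_eventually[OF S c] ln_lim]
    have ev3: "\<forall>\<^sub>F N in sequentially. ln (real N) \<ge> 1"
      using ln_lim by (simp add: filterlim_at_top)
    have ev4: "\<forall>\<^sub>F N in sequentially. inverse (real N * \<epsilon> N) * ln (real N) powr \<xi> < 1"
      by (rule order_tendstoD(2)[OF assms(12)]) simp
    have ev5: "\<forall>\<^sub>F N in sequentially. N \<ge> i" by (rule eventually_ge_at_top)
    from ev1 ev2 ev3 ev4 ev5 have "\<forall>\<^sub>F N in sequentially. norm (measure (M N) (space (M N) - E N))
        \<le> 1 * norm (exp (- (ln (real N) powr 2)))"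
    proof eventually_elim
      case (elim N)
      have N: "N \<ge> 1" using elim(5) i by simp
      define x where "x = real N * \<epsilon> N"
      define L where "L = ln (real N)"
      define m where "m = nat \<lceil>L\<^sup>2\<rceil>"
      have L: "L \<ge> 1" using elim(3) unfolding L_def .
      have x: "x > 0" unfolding x_def using N eps[OF N] by simp
      \<comment> \<open>Here \<open>\<xi> > 8\<close> enters: with \<open>L \<ge> 1\<close>,
        \<open>L powr \<xi>\<close> dominates \<open>L ^ 8\<close>, and it lies below
        \<open>x\<close> once the assumed null sequence is less than 1.\<close>
      have "L ^ 8 = L powr 8" using L by (simp add: powr_numeral)
      also have "\<dots> \<le> L powr \<xi>" using L assms(11) by (intro powr_mono) auto
      also have "\<dots> \<le> x" using elim(4) x unfolding x_def[symmetric] L_def[symmetric]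
        by (simp add: field_simps)
      finally have "L ^ 8 \<le> x" .
      moreover have "real N = exp L" unfolding L_def using N by simp
      ultimately have m: "m > 0" "1 \<le> x * S"
        "real N * real (Suc m) ^ (2 * m + 2) * (x * S) ^ m / (x * c) ^ (2 * m) \<le> exp (- (L\<^sup>2))"
        using elim(2) m_def unfolding L_def[symmetric] by blast+
      have NS: "real N * (\<epsilon> N * S) = x * S" unfolding x_def by simp
      have "measure (M N) (space (M N) - E N)
          \<le> real N * real (Suc m) ^ (2 * m + 2) * (real N * (\<epsilon> N * S)) ^ m / (x * c) ^ (2 * m)"
      proof (rule bernoulli_sym_matrix_spectral_deviation[OF assms(7)[OF N] bernN[OF N]])
        show "p N a b = p N b a" for a b unfolding p_def f_def by (simp add: kernel_fun_commute)
        show "0 \<le> p N a b \<and> p N a b \<le> \<epsilon> N * S" if "1 \<le> a" "a \<le> b" "b \<le> N" for a b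
        proof -
          have "real a / real N \<in> {0..1}" "real b / real N \<in> {0..1}" using that by auto
          from fS[OF this] show ?thesis unfolding p_def using eps[OF N] by simp
        qed
        show "0 \<le> \<epsilon> N * S" "\<epsilon> N * S \<le> 1" using eps[OF N] S epsS[OF N] by auto
        show "1 \<le> real N * (\<epsilon> N * S)" unfolding NS by (rule m(2))
        show "0 < x * c" using x c by simp
        show "0 < m" by fact
        show "E N \<in> sets (M N)" by (rule Esets[OF elim(5)])
      next
        fix \<omega> assume \<omega>: "\<omega> \<in> space (M N)"
          and quad: "\<And>y. \<bar>quad N (\<lambda>s t. A N \<omega> $$ (s, t) - p N (Suc s) (Suc t)) y\<bar> \<le> x * c * dot N y y"
        have "p N (Suc s) (Suc t) = \<epsilon> N * (\<Sum>j=1..k. \<theta> j * v N j s * v N j t)" for s t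
          unfolding p_def f_def kernel_fun_def v_def ..
        note quad' = quad[unfolded this]
        have gram: "\<bar>dot N (v N a) (v N b) / real N - (if a = b then 1 else 0)\<bar> \<le> \<eta>"
          if "a \<in> {1..k}" "b \<in> {1..k}" for a b
          using bspec[OF elim(1), of "(a, b)"] that by simp
        have carr: "A N \<omega> \<in> carrier_mat N N" "transpose_mat (A N \<omega>) = A N \<omega>"
          using bernN[OF N] \<omega> unfolding bernoulli_sym_matrix_def by auto
        have "\<bar>eigval i (A N \<omega>) - real N * \<epsilon> N * \<theta> i\<bar> \<le> real N * \<epsilon> N * \<theta> i * (k * \<eta>) + x * c"
          by (rule eigval_near_low_rank[OF carr \<theta> _ _ elim(5) eps[OF N] _ _ gram quad'])
             (use i \<eta> k\<eta> in auto)
        also have "\<dots> = x * \<theta> i * (k * \<eta> + \<delta> / 2)"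
          unfolding x_def c_def by (simp add: algebra_simps)
        also have "\<dots> \<le> x * \<theta> i * \<delta>"
          using k\<eta> x thi by (intro mult_left_mono) auto
        finally have "\<bar>eigval i (A N \<omega>) - x * \<theta> i\<bar> \<le> x * \<theta> i * \<delta>" unfolding x_def .
        moreover have "Y N \<omega> = (eigval i (A N \<omega>) - x * \<theta> i) / (x * \<theta> i)"
          unfolding Y_def x_def using N eps[OF N] thi by (simp add: diff_divide_distrib)
        ultimately have "\<bar>Y N \<omega>\<bar> \<le> \<delta>" using x thi
          by (simp add: abs_divide abs_mult pos_divide_le_eq mult_ac)
        thus "\<omega> \<in> E N" unfolding E_def using \<omega> by simp
      qed
      also have "\<dots> \<le> exp (- (L\<^sup>2))" using m(3) unfolding NS .
      also have "L\<^sup>2 = ln (real N) powr 2" using L unfolding L_def by (simp add: powr_numeral)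
      finally show ?case by simp
    qed
    hence "(\<lambda>N. measure (M N) (space (M N) - E N)) \<in> O(\<lambda>N. exp (- (ln (real N) powr 2)))"
      by (rule bigoI)
    moreover have "\<forall>\<^sub>F N in sequentially. E N \<in> sets (M N)"
      using eventually_ge_at_top[of i] by eventually_elim (rule Esets)
    \<comment> \<open>The exponent 2 demanded by \<open>whp\<close> is inherited from taking
      \<open>m\<close> about \<open>(log N)^2\<close>.\<close>
    ultimately show ?thesis unfolding whp_def E_def by (intro conjI exI[of _ 2]) auto
  qed
  hence "small_o_hp M Y (\<lambda>_ _. 1)" unfolding small_o_hp_def by blast
  moreover have "eigval i (A N \<omega>) = real N * \<epsilon> N * \<theta> i * (1 + Y N \<omega>)" if "N \<ge> i" for N \<omega>
    using eps[of N] thi that i unfolding Y_def by simp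
  ultimately show "\<exists>Y :: nat \<Rightarrow> 'a \<Rightarrow> real.
           (\<forall>N\<ge>i. Y N \<in> borel_measurable (M N)) \<and>
           small_o_hp M Y (\<lambda>_ _. 1) \<and>
           (\<forall>N\<ge>i. \<forall>\<omega>\<in>space (M N).
              eigval i (A N \<omega>) = real N * \<epsilon> N * \<theta> i * (1 + Y N \<omega>))"
    using meas by (intro exI[of _ Y]) blast
qed

end
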